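(* There is a randomized algorithm which, given a finite horizon Markov decision process $(S,A,P,r,H)$ with rewards in $[-M,M]$, a target accuracy $\epsilon>0$ and failure probability $\delta\in(0,1)$, returns an $\epsilon$-optimal non-stationary policy with probability at least $1-\delta$ in running time \[ \tilde O\left(\frac{|S|^{5/3}|A|H^{5/3}M^{2/3}}{\epsilon^{2/3}}\ln\left(\frac{|S||A|H}{\delta}\right)\right). \]
   Context: A finite horizon Markov decision process is a tuple $(S,A,P,r,H)$: finite state set $S$, finite action set $A$, for each $i\in S,a\in A$ a probability vector $p_a(i)\in\mathbb{R}^S$ ($p_a(i,j)$ is the probability of moving from $i$ to $j$ under action $a$), rewards $r_a(i)\in[-M,M]$ for a known $M>0$, and a horizon $H\in\mathbb{Z}^+$. A non-stationary policy assigns an action $\pi(i,h)\in A$ to every state $i$ and time $h\in\{0,1,\dots,H-1\}$; its value from state $i$ is the expected total (undiscounted) reward $\mathbb{E}[\sum_{h=0}^{H-1}r_{\pi(i_h,h)}(i_h)\mid i_0=i]$ of the trajectory it generates (with termination reward $0$). A policy is $\epsilon$-optimal if for every starting state its value is within $\epsilon$ of the maximum value achievable by any non-stationary policy. The input is given explicitly, and in addition for any $i\in S,a\in A$ an independent sample $j$ with $\Pr[j=k]=p_a(i,k)$ can be drawn in expected $O(1)$ time. $\tilde O$ hides polylogarithmic factors. *)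

theory Defs
  imports "HOL-Probability.Probability"
begin

section \<open>Finite horizon Markov decision processes\<close>

text \<open>
  An MDP is an algorithm input, so states and actions are numbered: the state set is
  \<open>{..<n_states X}\<close> and the action set \<open>{..<n_actions X}\<close>.  The probability
  vector \<open>p_a(i)\<close> is \<open>trans X a i\<close>, i.e. \<open>p_a(i,j) = pmf (trans X a i) j\<close>, and
  \<open>r_a(i)\<close> is \<open>reward X a i\<close>.
\<close>

record mdp =
  n_states :: nat
  n_actions :: nat
  trans :: "nat \<Rightarrow> nat \<Rightarrow> nat pmf"
  reward :: "nat \<Rightarrow> nat \<Rightarrow> real"
  horizon :: nat

definition finite_horizon_mdp :: "mdp \<Rightarrow> real \<Rightarrow> bool" where
  "finite_horizon_mdp X M \<longleftrightarrow>
     0 < n_states X \<and> 0 < n_actions X \<and> 0 < horizon X \<and> 0 < M \<and>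
     (\<forall>a<n_actions X. \<forall>i<n_states X.
        set_pmf (trans X a i) \<subseteq> {..<n_states X} \<and> reward X a i \<in> {-M..M})"

type_synonym policy = "nat \<Rightarrow> nat \<Rightarrow> nat"  \<comment> \<open>state, time, action\<close>

definition policies :: "mdp \<Rightarrow> policy set" where
  "policies X = {\<pi>. \<forall>i<n_states X. \<forall>h<horizon X. \<pi> i h < n_actions X}"

text \<open>
  \<open>trajectory X \<pi> n h i\<close> is the law of the list of the \<open>n\<close> states visited at times
  \<open>h, \<dots>, h + n - 1\<close>, given that the state at time \<open>h\<close> is \<open>i\<close>.
\<close>

primrec trajectory :: "mdp \<Rightarrow> policy \<Rightarrow> nat \<Rightarrow> nat \<Rightarrow> nat \<Rightarrow> nat list pmf" where
  "trajectory X \<pi> 0 h i = return_pmf []"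
| "trajectory X \<pi> (Suc n) h i =
     map_pmf ((#) i) (bind_pmf (trans X (\<pi> i h) i) (\<lambda>j. trajectory X \<pi> n (Suc h) j))"

definition policy_value :: "mdp \<Rightarrow> policy \<Rightarrow> nat \<Rightarrow> real" where
  "policy_value X \<pi> i =
     measure_pmf.expectation (trajectory X \<pi> (horizon X) 0 i)
       (\<lambda>\<omega>. \<Sum>h<horizon X. reward X (\<pi> (\<omega> ! h) h) (\<omega> ! h))"

text \<open>
  The supremum is a maximum: only the finitely many values \<open>\<pi> i h\<close> with
  \<open>i < n_states X\<close> and \<open>h < horizon X\<close> influence the value of a policy.
\<close>

definition optimal_value :: "mdp \<Rightarrow> nat \<Rightarrow> real" where
  "optimal_value X i = (SUP \<pi>\<in>policies X. policy_value X \<pi> i)"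

definition eps_optimal :: "mdp \<Rightarrow> real \<Rightarrow> policy \<Rightarrow> bool" where
  "eps_optimal X \<epsilon> \<pi> \<longleftrightarrow>
     \<pi> \<in> policies X \<and> (\<forall>i<n_states X. \<bar>optimal_value X i - policy_value X \<pi> i\<bar> \<le> \<epsilon>)"


section \<open>Randomized algorithms: a real RAM with sampling\<close>

text \<open>
  Algorithms are programs of a small imperative language, interpreted on a real RAM.  The
  memory consists of integer and real variables and of integer and real arrays, all initially
  \<open>0\<close>.  Integers admit \<open>+\<close>, truncated \<open>-\<close>, \<open>*\<close> and comparison, and can be converted to
  reals; reals admit the field operations and comparison.  There is deliberately no rounding,
  no integer division, which at unit cost would allow data to be packed into single numbers, and
  no real literal, which could be an uncomputable constant.

  Programs have random access to the entries of the input (\<open>TransE a i j\<close> reads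
  \<open>p_a(i,j)\<close>, \<open>RewardE a i\<close> reads \<open>r_a(i)\<close>).  The command \<open>Sample x a i\<close> stores a
  fresh sample from \<open>p_a(i)\<close> in the integer variable \<open>x\<close>.
\<close>

type_synonym vname = string

datatype nexp =
    NLit nat
  | NVar vname
  | NArr vname nexp
  | NAdd nexp nexp
  | NSub nexp nexp
  | NMul nexp nexp

datatype rexp =
    OfNat nexp
  | RVar vname
  | RArr vname nexp
  | RAdd rexp rexp
  | RSub rexp rexp
  | RMul rexp rexp
  | RDiv rexp rexp
  | TransE nexp nexp nexp
  | RewardE nexp nexp

datatype bexp =
    NLess nexp nexp
  | RLess rexp rexp
  | Not bexp
  | And bexp bexp

datatype com =
    Skip
  | NSet vname nexp
  | RSet vname rexp
  | NStore vname nexp nexp  \<comment> \<open>array, index, value\<close>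
  | RStore vname nexp rexp
  | Sample vname nexp nexp
  | Seq com com
  | If bexp com com
  | While bexp com

record memory =
  nvar :: "vname \<Rightarrow> nat"
  rvar :: "vname \<Rightarrow> real"
  narr :: "vname \<Rightarrow> nat \<Rightarrow> nat"
  rarr :: "vname \<Rightarrow> nat \<Rightarrow> real"

primrec nval :: "memory \<Rightarrow> nexp \<Rightarrow> nat" where
  "nval s (NLit n) = n"
| "nval s (NVar x) = nvar s x"
| "nval s (NArr x e) = narr s x (nval s e)"
| "nval s (NAdd e f) = nval s e + nval s f"
| "nval s (NSub e f) = nval s e - nval s f"
| "nval s (NMul e f) = nval s e * nval s f"

primrec rval :: "mdp \<Rightarrow> memory \<Rightarrow> rexp \<Rightarrow> real" where
  "rval X s (OfNat e) = real (nval s e)"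
| "rval X s (RVar x) = rvar s x"
| "rval X s (RArr x e) = rarr s x (nval s e)"
| "rval X s (RAdd e f) = rval X s e + rval X s f"
| "rval X s (RSub e f) = rval X s e - rval X s f"
| "rval X s (RMul e f) = rval X s e * rval X s f"
| "rval X s (RDiv e f) = rval X s e / rval X s f"
| "rval X s (TransE a i j) = pmf (trans X (nval s a) (nval s i)) (nval s j)"
| "rval X s (RewardE a i) = reward X (nval s a) (nval s i)"

primrec bval :: "mdp \<Rightarrow> memory \<Rightarrow> bexp \<Rightarrow> bool" where
  "bval X s (NLess e f) \<longleftrightarrow> nval s e < nval s f"
| "bval X s (RLess e f) \<longleftrightarrow> rval X s e < rval X s f"
| "bval X s (Not b) \<longleftrightarrow> \<not> bval X s b"
| "bval X s (And b c) \<longleftrightarrow> bval X s b \<and> bval X s c"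

text \<open>
  A sampler gives, for every action and state, the joint law of the sample it returns and the
  time it takes to draw it.  The time may be random and may depend on the sample.  Drawing takes
  expected time \<open>O(1)\<close>, namely at most \<open>\<tau>\<close>.
\<close>

type_synonym sampler = "nat \<Rightarrow> nat \<Rightarrow> (nat \<times> nat) pmf"

definition valid_sampler :: "mdp \<Rightarrow> real \<Rightarrow> sampler \<Rightarrow> bool" where
  "valid_sampler X \<tau> D \<longleftrightarrow>
     (\<forall>a<n_actions X. \<forall>i<n_states X.
        map_pmf fst (D a i) = trans X a i \<and>
        (\<integral>\<^sup>+ jt. ennreal (real (snd jt)) \<partial>measure_pmf (D a i)) \<le> ennreal \<tau>)"

text \<open>
  \<open>exec\<close> yields the joint law of the final memory and the running time, as a subprobability
  mass function whose missing mass is the probability of divergence.  Every assignment and every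
  evaluation of a guard costs one time unit; a \<open>Sample\<close> costs in addition the time of the
  sampler.  Expressions are part of the program text, hence of size independent of the input, so
  charging for their individual operations would change times only by a factor that depends on
  the program alone.
\<close>

partial_function (spmf) exec_while ::
    "('s \<Rightarrow> bool) \<Rightarrow> ('s \<Rightarrow> ('s \<times> nat) spmf) \<Rightarrow> 's \<Rightarrow> ('s \<times> nat) spmf" where
  "exec_while b c s =
     (if b s
      then bind_spmf (c s) (\<lambda>(s', t).
             map_spmf (\<lambda>(s'', t'). (s'', 1 + t + t')) (exec_while b c s'))
      else return_spmf (s, 1))"

primrec exec :: "mdp \<Rightarrow> sampler \<Rightarrow> com \<Rightarrow> memory \<Rightarrow> (memory \<times> nat) spmf" where
  "exec X D Skip = (\<lambda>s. return_spmf (s, 1))"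
| "exec X D (NSet x e) =
     (\<lambda>s. return_spmf (s\<lparr>nvar := (nvar s)(x := nval s e)\<rparr>, 1))"
| "exec X D (RSet x e) =
     (\<lambda>s. return_spmf (s\<lparr>rvar := (rvar s)(x := rval X s e)\<rparr>, 1))"
| "exec X D (NStore x k e) =
     (\<lambda>s. return_spmf (s\<lparr>narr := (narr s)(x := (narr s x)(nval s k := nval s e))\<rparr>, 1))"
| "exec X D (RStore x k e) =
     (\<lambda>s. return_spmf (s\<lparr>rarr := (rarr s)(x := (rarr s x)(nval s k := rval X s e))\<rparr>, 1))"
| "exec X D (Sample x a i) =
     (\<lambda>s. map_spmf (\<lambda>(j, t). (s\<lparr>nvar := (nvar s)(x := j)\<rparr>, 1 + t))
            (spmf_of_pmf (D (nval s a) (nval s i))))"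
| "exec X D (Seq c d) =
     (\<lambda>s. bind_spmf (exec X D c s) (\<lambda>(s', t).
            map_spmf (\<lambda>(s'', t'). (s'', t + t')) (exec X D d s')))"
| "exec X D (If b c d) =
     (\<lambda>s. map_spmf (\<lambda>(s', t). (s', 1 + t))
            (if bval X s b then exec X D c s else exec X D d s))"
| "exec X D (While b c) = exec_while (\<lambda>s. bval X s b) (exec X D c)"


section \<open>Solving an MDP\<close>

record problem =
  the_mdp :: mdp
  bound :: real  \<comment> \<open>\<open>M\<close>\<close>
  accuracy :: real  \<comment> \<open>\<open>\<epsilon>\<close>\<close>
  failure :: real  \<comment> \<open>\<open>\<delta>\<close>\<close>

definition instances :: "real \<Rightarrow> (problem \<times> sampler) set" where
  "instances \<tau> = {(I, D).
     finite_horizon_mdp (the_mdp I) (bound I) \<and> 0 < accuracy I \<and>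
     0 < failure I \<and> failure I < 1 \<and> valid_sampler (the_mdp I) \<tau> D}"

definition initial_memory :: "problem \<Rightarrow> memory" where
  "initial_memory I =
     \<lparr>nvar = (\<lambda>_. 0)(''S'' := n_states (the_mdp I), ''A'' := n_actions (the_mdp I),
                     ''H'' := horizon (the_mdp I)),
      rvar = (\<lambda>_. 0)(''M'' := bound I, ''epsilon'' := accuracy I, ''delta'' := failure I),
      narr = (\<lambda>_ _. 0),
      rarr = (\<lambda>_ _. 0)\<rparr>"

text \<open>The result \<open>\<pi>(i,h)\<close> is returned in cell \<open>h * |S| + i\<close> of the array \<open>''pi''\<close>.\<close>

definition output_policy :: "problem \<Rightarrow> memory \<Rightarrow> policy" where
  "output_policy I s = (\<lambda>i h. narr s ''pi'' (h * n_states (the_mdp I) + i))"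

definition run :: "com \<Rightarrow> problem \<times> sampler \<Rightarrow> (memory \<times> nat) spmf" where
  "run c = (\<lambda>(I, D). exec (the_mdp I) D c (initial_memory I))"

definition success_probability :: "com \<Rightarrow> problem \<times> sampler \<Rightarrow> real" where
  "success_probability c ID =
     measure (measure_spmf (run c ID))
       {(s, t). eps_optimal (the_mdp (fst ID)) (accuracy (fst ID)) (output_policy (fst ID) s)}"

definition expected_time :: "com \<Rightarrow> problem \<times> sampler \<Rightarrow> ennreal" where
  "expected_time c ID = (\<integral>\<^sup>+ st. ennreal (real (snd st)) \<partial>measure_spmf (run c ID))"

text \<open>
  \<open>T\<close> is \<open>f\<close> times a polylogarithmic factor, \<open>f log(f)^O(1)\<close>, uniformly on \<open>U\<close>.  As
  usual for running times, a bound \<open>f\<close> below one time unit is read as one time unit.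
\<close>

definition soft_O :: "'x set \<Rightarrow> ('x \<Rightarrow> ennreal) \<Rightarrow> ('x \<Rightarrow> real) \<Rightarrow> bool" where
  "soft_O U T f \<longleftrightarrow>
     (\<exists>(C::real) (k::nat). \<forall>x\<in>U.
        T x \<le> ennreal (C * max 1 (f x) * (1 + ln (max 1 (f x))) ^ k))"

end

theory Submission
  imports Defs
begin

text \<open>
  Backward value iteration on the states at \<open>n\<close> steps to go, in blocks of \<open>k + 1\<close> steps.  At the
  start \<open>b\<close> of a block the expectations \<open>P v_b\<close> are computed exactly, in time \<open>S\<^sup>2 A\<close>; inside
  the block \<open>P v_n\<close> is estimated as \<open>P v_b\<close> plus a sample mean of \<open>v_n - v_b\<close>.  Exact values
  change by at most \<open>M\<close> per step, so forcing \<open>v_(n+1)\<close> into \<open>[v_n - M, v_n + M]\<close> does no harm, and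
  it bounds \<open>v_n - v_b\<close> by \<open>k M\<close>.  By Hoeffding, about \<open>(k M H / \<epsilon>)\<^sup>2\<close> samples (up to a
  logarithm) give every estimate an error of at most \<open>e = \<epsilon> / (2 H)\<close>.  The total time is about
  \<open>S\<^sup>2 A H / k + S A H (k M H / \<epsilon>)\<^sup>2\<close>, and \<open>k\<^sup>3 = S \<epsilon>\<^sup>2 / (H M)\<^sup>2\<close> balances the two
  terms.

  The values satisfy \<open>v_n \<ge> v*_n - n e\<close>.  When the lower clamp is active, the action of the
  previous step is kept; this preserves \<open>v_(n+1) \<le> T_\<pi> v_n + e\<close> for the backup \<open>T_\<pi>\<close> of the
  computed policy, whose value is therefore at least \<open>v_n - n e\<close>.
\<close>

section \<open>Quantitative program logic\<close>

text \<open>The two clamps are not symmetric. Lowering a value only threatens the comparison with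
  the optimal values, and these rise by at most \<open>M\<close> per step. Raising a value to
  \<open>v_n - M\<close> threatens the promise that some action attains it. The inherited action
  does: its backup of \<open>v_(n-1)\<close> reached \<open>v_n\<close> up to \<open>e\<close>, and
  its backup of \<open>v_n\<close> is at most \<open>M\<close> lower. The sampled function
  \<open>v_n - v_b\<close> is itself random, so Hoeffding's bound is applied conditionally: the
  samples of one estimate are fresh given the memory at its start. Hence failure probabilities
  travel through programs as postexpectations, and the union bound over the \<open>S A H\<close>
  estimates is taken along the loops. Each step loses \<open>e\<close> twice, once against the
  optimum and once for the computed policy, which explains \<open>e = \<epsilon> / (2 H)\<close>. If
  \<open>\<epsilon> \<ge> 2 H M\<close>, every policy will do; excluding this case keeps the
  balancing real \<open>k\<close> at most \<open>2 S\<close>, so that the bound covers the bare cost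
  of visiting all \<open>S A H\<close> triples.\<close>

text \<open>
  The postexpectation \<open>\<Phi>\<close> has expected value at most \<open>c\<close>.  With \<open>\<Phi>\<close> the indicator of a bad
  event this bounds a failure probability, with an exponential \<open>\<Phi>\<close> it yields Chernoff bounds.
\<close>
definition ok :: "('s \<times> nat) spmf \<Rightarrow> real \<Rightarrow> ('s \<Rightarrow> bool) \<Rightarrow> ('s \<Rightarrow> ennreal) \<Rightarrow> ennreal \<Rightarrow> bool" where
  "ok m T W \<Phi> c \<longleftrightarrow>
     0 \<le> T \<and> lossless_spmf m \<and> (\<forall>(s, t) \<in> set_spmf m. W s) \<and>
     (\<integral>\<^sup>+ st. ennreal (real (snd st)) \<partial>measure_spmf m) \<le> ennreal T \<and>
     (\<integral>\<^sup>+ st. \<Phi> (fst st) \<partial>measure_spmf m) \<le> c"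

lemma nn_integral_bind_spmf:
  "(\<integral>\<^sup>+ y. g y \<partial>measure_spmf (bind_spmf p f)) =
   (\<integral>\<^sup>+ x. (\<integral>\<^sup>+ y. g y \<partial>measure_spmf (f x)) \<partial>measure_spmf p)"
  unfolding measure_spmf_bind
  by (subst nn_integral_bind[where B = "count_space UNIV"])
     (auto simp: space_subprob_algebra intro!: measure_spmf.subprob_space_axioms)

lemma lossless_emeasure_space:
  "lossless_spmf m \<Longrightarrow> emeasure (measure_spmf m) (space (measure_spmf m)) = 1"
  using lossless_spmf_def[of m] by (simp add: measure_spmf.emeasure_eq_measure weight_spmf_def)

lemma nn_integral_spmf_le_const:
  assumes "\<And>x. x \<in> set_spmf m \<Longrightarrow> f x \<le> c"
  shows "(\<integral>\<^sup>+ x. f x \<partial>measure_spmf m) \<le> c"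
proof -
  have "(\<integral>\<^sup>+ x. f x \<partial>measure_spmf m) \<le> (\<integral>\<^sup>+ x. c \<partial>measure_spmf m)"
    by (rule nn_integral_mono_AE) (use assms in auto)
  also have "\<dots> \<le> c"
    using measure_spmf.emeasure_space_le_1[of m] mult_left_mono[of "emeasure (measure_spmf m) (space (measure_spmf m))" 1 c] by simp
  finally show ?thesis .
qed

lemma ok_return: "W s \<Longrightarrow> \<Phi> s \<le> c \<Longrightarrow> real t \<le> T \<Longrightarrow> ok (return_spmf (s, t)) T W \<Phi> c"
  unfolding ok_def by (auto simp: measure_spmf_return_spmf nn_integral_return intro!: ennreal_leI)

lemma ok_mono:
  assumes "ok m T W \<Phi> c" "T \<le> T'" "\<And>s. W s \<Longrightarrow> W' s" "\<And>s. W s \<Longrightarrow> \<Phi>' s \<le> \<Phi> s" "c \<le> c'"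
  shows "ok m T' W' \<Phi>' c'"
proof -
  have "(\<integral>\<^sup>+ st. \<Phi>' (fst st) \<partial>measure_spmf m) \<le> (\<integral>\<^sup>+ st. \<Phi> (fst st) \<partial>measure_spmf m)"
    by (rule nn_integral_mono_AE) (use assms in \<open>fastforce simp: ok_def\<close>)
  then show ?thesis
    using assms unfolding ok_def
    by (auto intro: order_trans ennreal_leI)
qed

text \<open>The total mass is at most 1, so a pointwise bound survives integration. This lets a
  deterministic result, proved with postexpectation 0, pass on any constant failure budget.\<close>

lemma ok_const:
  assumes "ok m T W \<Phi> c" "\<And>s. W s \<Longrightarrow> \<Phi>' s \<le> c'"
  shows "ok m T W \<Phi>' c'"
  using assms unfolding ok_def by (auto intro!: nn_integral_spmf_le_const)

text \<open>Time and probability compose differently: the time bound \<open>Tb\<close> is uniform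
  over the intermediate states, whereas the postexpectation \<open>\<Phi>a\<close> is a function of
  them, as in a weakest preexpectation calculus. The number \<open>k\<close> is the overhead of the
  construct, for instance 1 for the guard of a loop.\<close>

lemma ok_bind:
  assumes p: "ok p Ta Wa \<Phi>a c"
    and f: "\<And>s. Wa s \<Longrightarrow> ok (f s) Tb Wb \<Phi>b (\<Phi>a s)"
    and T: "Ta + Tb + real k \<le> T"
  shows "ok (bind_spmf p (\<lambda>(s', t). map_spmf (\<lambda>(s'', t'). (s'', k + t + t')) (f s'))) T Wb \<Phi>b c"
    (is "ok ?m _ _ _ _")
proof -
  have AE: "AE x in measure_spmf p. Wa (fst x)"
    using p by (auto simp: ok_def)
  \<comment> \<open>A lossless \<open>p\<close> reaches some state, whose instance of the second
    premise yields \<open>0 \<le> Tb\<close>; only for nonnegative bounds is \<open>ennreal\<close>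
    additive.\<close>
  have "set_spmf p \<noteq> {}"
    using p measure_spmf_zero_iff[of p UNIV]
    by (auto simp: ok_def lossless_spmf_def weight_spmf_def)
  then obtain s0 t0 where "(s0, t0) \<in> set_spmf p" by auto
  with p f have Tb: "0 \<le> Tb" unfolding ok_def by blast
  have Ta: "0 \<le> Ta" using p by (simp add: ok_def)
  have "(\<integral>\<^sup>+ st. ennreal (real (snd st)) \<partial>measure_spmf ?m) =
     (\<integral>\<^sup>+ x. (\<integral>\<^sup>+ y. (ennreal (real k) + ennreal (real (snd x))) + ennreal (real (snd y))
         \<partial>measure_spmf (f (fst x))) \<partial>measure_spmf p)"
    by (simp add: nn_integral_bind_spmf case_prod_unfold o_def flip: ennreal_plus)
  also have "\<dots> \<le> (\<integral>\<^sup>+ x. (ennreal (real k) + ennreal (real (snd x))) + ennreal Tb \<partial>measure_spmf p)"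
  proof (rule nn_integral_mono_AE, rule AE_mp[OF AE], rule AE_I2, intro impI)
    fix x :: "_ \<times> nat" assume "Wa (fst x)"
    from f[OF this] have l: "lossless_spmf (f (fst x))"
      and t: "(\<integral>\<^sup>+ y. ennreal (real (snd y)) \<partial>measure_spmf (f (fst x))) \<le> ennreal Tb"
      by (auto simp: ok_def)
    show "(\<integral>\<^sup>+ y. (ennreal (real k) + ennreal (real (snd x))) + ennreal (real (snd y))
         \<partial>measure_spmf (f (fst x))) \<le> (ennreal (real k) + ennreal (real (snd x))) + ennreal Tb"
      using t by (subst nn_integral_add) (auto simp: lossless_emeasure_space[OF l] intro!: add_left_mono)
  qed
  also have "\<dots> = ennreal (real k) + (\<integral>\<^sup>+ x. ennreal (real (snd x)) \<partial>measure_spmf p) + ennreal Tb"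
    using p by (simp add: nn_integral_add ok_def lossless_emeasure_space)
  also have "\<dots> \<le> ennreal (real k) + ennreal Ta + ennreal Tb"
    using p by (auto simp: ok_def intro!: add_mono)
  also have "\<dots> = ennreal (real k + Ta + Tb)"
    using Ta Tb by simp
  also have "\<dots> \<le> ennreal T" using T by (intro ennreal_leI) simp
  finally have time: "(\<integral>\<^sup>+ st. ennreal (real (snd st)) \<partial>measure_spmf ?m) \<le> ennreal T" .
  have "(\<integral>\<^sup>+ st. \<Phi>b (fst st) \<partial>measure_spmf ?m) =
     (\<integral>\<^sup>+ x. (\<integral>\<^sup>+ y. \<Phi>b (fst y) \<partial>measure_spmf (f (fst x))) \<partial>measure_spmf p)"
    by (simp add: nn_integral_bind_spmf case_prod_unfold o_def)
  also have "\<dots> \<le> (\<integral>\<^sup>+ x. \<Phi>a (fst x) \<partial>measure_spmf p)"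
    by (rule nn_integral_mono_AE, rule AE_mp[OF AE], rule AE_I2) (use f in \<open>auto simp: ok_def\<close>)
  also have "\<dots> \<le> c" using p by (auto simp: ok_def)
  finally have "(\<integral>\<^sup>+ st. \<Phi>b (fst st) \<partial>measure_spmf ?m) \<le> c" .
  moreover have "lossless_spmf ?m" "\<forall>(s, t) \<in> set_spmf ?m. Wb s"
    using p f unfolding ok_def by (fastforce simp: set_bind_spmf)+
  ultimately show ?thesis using time T Ta Tb by (auto simp: ok_def)
qed

lemma ok_map_time:
  assumes "ok m T W \<Phi> c" "T + real k \<le> T'"
  shows "ok (map_spmf (\<lambda>(s, t). (s, k + t)) m) T' W \<Phi> c"
proof -
  have "ok (bind_spmf (return_spmf ((), 0)) (\<lambda>(s', t). map_spmf (\<lambda>(s'', t'). (s'', k + t + t')) m)) T' W \<Phi> c"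
    by (rule ok_bind[where Ta = 0 and Tb = T and Wa = "\<lambda>_. True" and \<Phi>a = "\<lambda>_. c"])
       (use assms in \<open>auto intro!: ok_return\<close>)
  then show ?thesis by simp
qed

lemma ok_Seq:
  assumes "ok (exec X D c s) Ta Wa \<Phi>a p"
    and "\<And>s'. Wa s' \<Longrightarrow> ok (exec X D d s') Tb Wb \<Phi>b (\<Phi>a s')"
    and "Ta + Tb \<le> T"
  shows "ok (exec X D (Seq c d) s) T Wb \<Phi>b p"
  using ok_bind[where k = 0, OF assms(1), of "exec X D d", OF assms(2)] assms(3) by simp

lemma ok_If:
  assumes "bval X s b \<Longrightarrow> ok (exec X D c s) T W \<Phi> p"
    and "\<not> bval X s b \<Longrightarrow> ok (exec X D d s) T W \<Phi> p"
    and "T + 1 \<le> T'"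
  shows "ok (exec X D (If b c d) s) T' W \<Phi> p"
  using ok_map_time[where k = 1, of "if bval X s b then exec X D c s else exec X D d s" T W \<Phi> p T'] assms
  by (auto split: if_splits)

text \<open>The number \<open>N\<close> of rounds is fixed in advance, so termination follows from
  an induction on the remaining rounds, and the invariant, the postexpectation and the time may
  depend on the round. The final 1 pays for the guard that fails.\<close>

lemma ok_While_aux:
  assumes body: "\<And>j s. j < N \<Longrightarrow> Inv j s \<Longrightarrow> bval X s b \<and>
      ok (exec X D c s) (T j) (Inv (Suc j)) (\<Phi> (Suc j)) (\<Phi> j s)"
    and exit: "\<And>s. Inv N s \<Longrightarrow> \<not> bval X s b"
    and "j \<le> N" "Inv j s"
  shows "ok (exec X D (While b c) s) ((\<Sum>i=j..<N. T i + 1) + 1) (Inv N) (\<Phi> N) (\<Phi> j s)"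
  using assms(3,4)
proof (induction "N - j" arbitrary: j s)
  case 0
  then have "j = N" by simp
  with 0 exit show ?case by (auto simp: exec_while.simps intro!: ok_return)
next
  case (Suc k)
  then have j: "j < N" by simp
  have "ok (bind_spmf (exec X D c s) (\<lambda>(s', t). map_spmf (\<lambda>(s'', t'). (s'', 1 + t + t'))
          (exec X D (While b c) s'))) ((\<Sum>i=j..<N. T i + 1) + 1) (Inv N) (\<Phi> N) (\<Phi> j s)"
  proof (rule ok_bind)
    show "ok (exec X D c s) (T j) (Inv (Suc j)) (\<Phi> (Suc j)) (\<Phi> j s)"
      using body[OF j] Suc.prems by simp
    show "ok (exec X D (While b c) s') ((\<Sum>i=Suc j..<N. T i + 1) + 1) (Inv N) (\<Phi> N) (\<Phi> (Suc j) s')"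
      if "Inv (Suc j) s'" for s'
      by (rule Suc.hyps(1)) (use Suc.hyps(2) j that in auto)
  qed (use j in \<open>simp add: sum.atLeast_Suc_lessThan\<close>)
  then show ?case
    using body[OF j \<open>Inv j s\<close>] by (subst exec.simps, subst exec_while.simps) simp
qed

lemma ok_While:
  assumes "Inv 0 s"
    and "\<And>j s. j < N \<Longrightarrow> Inv j s \<Longrightarrow> bval X s b"
    and "\<And>j s. j < N \<Longrightarrow> Inv j s \<Longrightarrow> ok (exec X D c s) (T j) (Inv (Suc j)) (\<Phi> (Suc j)) (\<Phi> j s)"
    and "\<And>s. Inv N s \<Longrightarrow> \<not> bval X s b"
    and "(\<Sum>i<N. T i + 1) + 1 \<le> T'"
  shows "ok (exec X D (While b c) s) T' (Inv N) (\<Phi> N) (\<Phi> 0 s)"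
  using ok_While_aux[of N Inv X b D c T \<Phi> 0 s] assms
  by (auto intro: ok_mono simp: lessThan_atLeast0)

text \<open>Losslessness gives the success and failure events total mass 1, so a bound on failure
  converts into one on success.\<close>

lemma ok_success:
  assumes "ok m T W (\<lambda>s. of_bool (\<not> G s)) (ennreal p)" "0 \<le> p"
  shows "1 - p \<le> measure (measure_spmf m) {(s, t). G s}"
proof -
  have m: "lossless_spmf m" and p: "(\<integral>\<^sup>+ st. of_bool (\<not> G (fst st)) \<partial>measure_spmf m) \<le> ennreal p"
    using assms by (auto simp: ok_def)
  have "(\<integral>\<^sup>+ st. of_bool (\<not> G (fst st)) \<partial>measure_spmf m) =
      (\<integral>\<^sup>+ st. indicator (- {(s, t). G s}) st \<partial>measure_spmf m)"
    by (intro nn_integral_cong) (auto simp: indicator_def)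
  also have "\<dots> = emeasure (measure_spmf m) (- {(s, t). G s})"
    by (rule nn_integral_indicator) simp
  finally have "measure (measure_spmf m) (- {(s, t). G s}) \<le> p"
    using p assms(2) by (simp add: measure_spmf.emeasure_eq_measure)
  moreover have "measure (measure_spmf m) (- {(s, t). G s}) = 1 - measure (measure_spmf m) {(s, t). G s}"
    using measure_spmf.finite_measure_compl[of "{(s, t). G s}" m] m
    by (simp add: lossless_spmf_def weight_spmf_def Compl_eq_Diff_UNIV space_measure_spmf)
  ultimately show ?thesis by simp
qed

lemma ok_Seq_return:
  assumes "exec X D c s = return_spmf (s', t)" "ok (exec X D d s') Tb W \<Phi> p" "real t + Tb \<le> T"
  shows "ok (exec X D (Seq c d) s) T W \<Phi> p"
  by (rule ok_Seq[where Ta = "real t" and Wa = "\<lambda>s''. s'' = s'" and \<Phi>a = "\<lambda>_. p"])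
     (use assms in \<open>auto intro!: ok_return\<close>)

text \<open>The sampler may correlate its time with the sample; this is harmless, because time and
  postexpectation are bounded by separate integrals, each involving one marginal. The real
  \<open>\<tau>\<close> may be negative, where \<open>ennreal\<close> reads it as 0, hence
  \<open>max 0 \<tau>\<close>.\<close>

lemma ok_Sample:
  assumes "valid_sampler X \<tau> D" "nval s a < n_actions X" "nval s i < n_states X"
    and W: "\<And>j. j \<in> set_pmf (trans X (nval s a) (nval s i)) \<Longrightarrow> W (s\<lparr>nvar := (nvar s)(x := j)\<rparr>)"
    and \<Phi>: "(\<integral>\<^sup>+ j. \<Phi> (s\<lparr>nvar := (nvar s)(x := j)\<rparr>) \<partial>measure_pmf (trans X (nval s a) (nval s i))) \<le> p"
    and T: "1 + max 0 \<tau> \<le> T"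
  shows "ok (exec X D (Sample x a i) s) T W \<Phi> p"
proof -
  let ?D = "D (nval s a) (nval s i)"
  have tr: "trans X (nval s a) (nval s i) = map_pmf fst ?D"
    and \<tau>: "(\<integral>\<^sup>+ jt. ennreal (real (snd jt)) \<partial>measure_pmf ?D) \<le> ennreal \<tau>"
    using assms(1-3) by (auto simp: valid_sampler_def)
  have "(\<integral>\<^sup>+ jt. ennreal (1 + real (snd jt)) \<partial>measure_pmf ?D) =
      1 + (\<integral>\<^sup>+ jt. ennreal (real (snd jt)) \<partial>measure_pmf ?D)"
    by (simp add: nn_integral_add ennreal_plus del: ennreal_1)
  also have "\<dots> \<le> 1 + ennreal (max 0 \<tau>)"
    by (intro add_left_mono order_trans[OF \<tau>] ennreal_leI) simp
  also have "\<dots> = ennreal (1 + max 0 \<tau>)"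
    by (simp flip: ennreal_1 add: ennreal_plus)
  also have "\<dots> \<le> ennreal T" using T by (rule ennreal_leI)
  finally have "(\<integral>\<^sup>+ jt. ennreal (1 + real (snd jt)) \<partial>measure_pmf ?D) \<le> ennreal T" .
  moreover have "0 \<le> T" using T by linarith
  ultimately show ?thesis
    using \<Phi> W unfolding tr by (auto simp: ok_def case_prod_unfold o_def)
qed

section \<open>Counted loops and the union bound\<close>

definition For :: "vname \<Rightarrow> nexp \<Rightarrow> com \<Rightarrow> com" where
  "For x n c = Seq (NSet x (NLit 0)) (While (NLess (NVar x) n) (Seq c (NSet x (NAdd (NVar x) (NLit 1)))))"

abbreviation set_nvar :: "vname \<Rightarrow> nat \<Rightarrow> memory \<Rightarrow> memory" where
  "set_nvar x k s \<equiv> s\<lparr>nvar := (nvar s)(x := k)\<rparr>"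

text \<open>\<open>Inv\<close> and \<open>\<Phi>\<close> speak of the memory after the counter has
  been advanced, so the body must leave \<open>x\<close> alone and its postcondition goes through
  \<open>set_nvar\<close>. Each round pays 2 for increment and guard; the last 2 are the initial
  assignment and the failing guard.\<close>

lemma ok_For:
  assumes init: "Inv 0 (set_nvar x 0 s)" "\<Phi> 0 (set_nvar x 0 s) \<le> p"
    and var: "\<And>j s. j \<le> N \<Longrightarrow> Inv j s \<Longrightarrow> nvar s x = j \<and> nval s n = N"
    and body: "\<And>j s. j < N \<Longrightarrow> Inv j s \<Longrightarrow>
        ok (exec X D c s) (T j) (\<lambda>s'. nvar s' x = j \<and> Inv (Suc j) (set_nvar x (Suc j) s'))
           (\<lambda>s'. \<Phi> (Suc j) (set_nvar x (Suc j) s')) (\<Phi> j s)"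
    and T: "(\<Sum>j<N. T j + 2) + 2 \<le> T'"
  shows "ok (exec X D (For x n c) s) T' (Inv N) (\<Phi> N) p"
  unfolding For_def
proof (rule ok_Seq_return)
  let ?b = "NLess (NVar x) n" and ?c = "Seq c (NSet x (NAdd (NVar x) (NLit 1)))"
  have "ok (exec X D (While ?b ?c) (set_nvar x 0 s)) ((\<Sum>j<N. T j + 2) + 1) (Inv N) (\<Phi> N)
      (\<Phi> 0 (set_nvar x 0 s))"
  proof (rule ok_While)
    fix j s assume j: "j < N" and inv: "Inv j s"
    show "bval X s ?b" using var[OF _ inv] j by auto
    show "ok (exec X D ?c s) (T j + 1) (Inv (Suc j)) (\<Phi> (Suc j)) (\<Phi> j s)"
      by (rule ok_Seq[OF body[OF j inv]]) (auto intro!: ok_return)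
  qed (use init var[of N] in \<open>auto simp: add.commute\<close>)
  then show "ok (exec X D (While ?b ?c) (set_nvar x 0 s)) ((\<Sum>j<N. T j + 2) + 1) (Inv N) (\<Phi> N) p"
    by (rule ok_mono) (use init in auto)
qed (use T in auto)

text \<open>A failure is charged once. If \<open>g\<close> still holds, the command may break it at
  price \<open>p\<close>; if \<open>g\<close> has already failed, the term
  \<open>of_bool (\<not> g) = 1\<close> on the right has paid for every later failure.\<close>

lemma ok_budget:
  assumes "ok m T W (\<lambda>s. of_bool (g \<and> \<not> g' s)) p"
  shows "ok m T W (\<lambda>s. of_bool (\<not> g' s) + c) (of_bool (\<not> g) + (p + c))"
proof (cases g)
  case True
  then have "(\<integral>\<^sup>+ st. of_bool (\<not> g' (fst st)) + c \<partial>measure_spmf m) \<le> p + c"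
    using assms by (subst nn_integral_add)
      (auto simp: ok_def lossless_emeasure_space intro!: add_right_mono)
  with True assms show ?thesis by (auto simp: ok_def)
next
  case False
  show ?thesis
    by (rule ok_const[OF assms]) (use False in \<open>auto simp: add_increasing intro!: add_mono\<close>)
qed

text \<open>The union bound as a supermartingale: the potential is the indicator of a past failure
  plus \<open>p\<close> for each round still to come. The body has to account only for failures that
  are new in its round.\<close>

lemma ok_For_fail:
  assumes init: "Inv 0 (set_nvar x 0 s)" "g 0 (set_nvar x 0 s)"
    and var: "\<And>j s. j \<le> N \<Longrightarrow> Inv j s \<Longrightarrow> nvar s x = j \<and> nval s n = N"
    and body: "\<And>j s. j < N \<Longrightarrow> Inv j s \<Longrightarrow>
        ok (exec X D c s) (T j) (\<lambda>s'. nvar s' x = j \<and> Inv (Suc j) (set_nvar x (Suc j) s'))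
           (\<lambda>s'. of_bool (g j s \<and> \<not> g (Suc j) (set_nvar x (Suc j) s'))) p"
    and T: "(\<Sum>j<N. T j + 2) + 2 \<le> T'"
  shows "ok (exec X D (For x n c) s) T' (Inv N) (\<lambda>s'. of_bool (\<not> g N s')) (of_nat N * p)"
proof -
  have "ok (exec X D (For x n c) s) T' (Inv N) (\<lambda>s'. of_bool (\<not> g N s') + of_nat (N - N) * p) (of_nat N * p)"
  proof (rule ok_For[where \<Phi> = "\<lambda>j s'. of_bool (\<not> g j s') + of_nat (N - j) * p"])
    fix j s assume j: "j < N" and inv: "Inv j s"
    have *: "of_nat (N - j) * p = p + of_nat (N - Suc j) * p"
      using j by (metis Suc_diff_Suc distrib_right mult_1 of_nat_Suc)
    show "ok (exec X D c s) (T j) (\<lambda>s'. nvar s' x = j \<and> Inv (Suc j) (set_nvar x (Suc j) s'))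
        (\<lambda>s'. of_bool (\<not> g (Suc j) (set_nvar x (Suc j) s')) + of_nat (N - Suc j) * p)
        (of_bool (\<not> g j s) + of_nat (N - j) * p)"
      unfolding * by (rule ok_budget[OF body[OF j inv]])
  qed (use assms in auto)
  then show ?thesis by simp
qed

lemma ok_For_det:
  assumes init: "Inv 0 (set_nvar x 0 s)"
    and var: "\<And>j s. j \<le> N \<Longrightarrow> Inv j s \<Longrightarrow> nvar s x = j \<and> nval s n = N"
    and body: "\<And>j s. j < N \<Longrightarrow> Inv j s \<Longrightarrow>
        ok (exec X D c s) (T j) (\<lambda>s'. nvar s' x = j \<and> Inv (Suc j) (set_nvar x (Suc j) s')) (\<lambda>_. 0) 0"
    and T: "(\<Sum>j<N. T j + 2) + 2 \<le> T'"
  shows "ok (exec X D (For x n c) s) T' (Inv N) (\<lambda>_. 0) 0"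
  by (rule ok_For[where \<Phi> = "\<lambda>_ _. 0"]) (use assms in auto)

section \<open>Estimating an expectation by sampling\<close>

text \<open>Hoeffding's lemma for the interval from \<open>-B\<close> to \<open>B\<close>: the
  squared width over 8 is half of \<open>B\<close> squared.\<close>

lemma nn_integral_exp_pmf_le:
  fixes d :: "nat \<Rightarrow> real"
  assumes "0 < l" and d: "\<And>x. x \<in> set_pmf q \<Longrightarrow> \<bar>d x\<bar> \<le> B"
  shows "(\<integral>\<^sup>+ x. ennreal (exp (l * (d x - measure_pmf.expectation q d))) \<partial>measure_pmf q)
           \<le> ennreal (exp (l\<^sup>2 * B\<^sup>2 / 2))"
proof -
  interpret interval_bounded_random_variable "measure_pmf q" d "- B" B
    by unfold_locales (use d in \<open>force simp: AE_measure_pmf_iff abs_le_iff\<close>)+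
  show ?thesis
    using Hoeffdings_lemma_nn_integral[OF \<open>0 < l\<close>] by (simp add: power_mult_distrib mult.commute)
qed

definition eq_off :: "'a set \<Rightarrow> ('a \<Rightarrow> 'b) \<Rightarrow> ('a \<Rightarrow> 'b) \<Rightarrow> bool" where
  "eq_off V f g \<longleftrightarrow> (\<forall>x. x \<notin> V \<longrightarrow> g x = f x)"

lemma eq_off_update [simp]: "x \<in> V \<Longrightarrow> eq_off V f (g(x := y)) = eq_off V f g"
  by (auto simp: eq_off_def)

lemma eq_off_refl [simp]: "eq_off V f f"
  by (simp add: eq_off_def)

text \<open>A frame condition: \<open>NV\<close> and \<open>RV\<close> collect the variables that
  may have changed. Arrays are left to separate conjuncts, since the loops differ in which cells
  they write.\<close>

definition same :: "vname set \<Rightarrow> vname set \<Rightarrow> memory \<Rightarrow> memory \<Rightarrow> bool" where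
  "same NV RV s s' \<longleftrightarrow> eq_off NV (nvar s) (nvar s') \<and> eq_off RV (rvar s) (rvar s')"

lemma same_trans:
  "same NV RV s s' \<Longrightarrow> same NV' RV' s' s'' \<Longrightarrow> NV' \<subseteq> NV \<Longrightarrow> RV' \<subseteq> RV \<Longrightarrow> same NV RV s s''"
  unfolding same_def eq_off_def subset_iff by metis

lemma same_nvar: "same NV RV s s' \<Longrightarrow> x \<notin> NV \<Longrightarrow> nvar s' x = nvar s x"
  and same_rvar: "same NV RV s s' \<Longrightarrow> y \<notin> RV \<Longrightarrow> rvar s' y = rvar s y"
  by (auto simp: same_def eq_off_def)

abbreviation vcell :: "nexp \<Rightarrow> nexp \<Rightarrow> rexp" where
  "vcell n i \<equiv> RArr ''v'' (NAdd (NMul n (NVar ''S'')) i)"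

definition sample_loop :: com where
  "sample_loop = For ''j'' (NVar ''m'')
     (Seq (Sample ''x'' (NVar ''a'') (NVar ''i''))
          (RSet ''acc'' (RAdd (RVar ''acc'')
             (RSub (vcell (NVar ''n'') (NVar ''x'')) (vcell (NVar ''b'') (NVar ''x''))))))"

lemma ok_sample_loop:
  fixes s :: memory and X :: mdp
  defines "a \<equiv> nvar s ''a''" and "i \<equiv> nvar s ''i''" and "m \<equiv> nvar s ''m''"
  defines "d \<equiv> \<lambda>x. rarr s ''v'' (nvar s ''n'' * nvar s ''S'' + x) - rarr s ''v'' (nvar s ''b'' * nvar s ''S'' + x)"
  defines "\<Delta> \<equiv> measure_pmf.expectation (trans X a i) d"
  assumes smp: "valid_sampler X \<tau> D" "a < n_actions X" "i < n_states X"
    and acc: "rvar s ''acc'' = 0"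
    and d: "\<And>x. x \<in> set_pmf (trans X a i) \<Longrightarrow> \<bar>d x\<bar> \<le> B"
    and e: "0 < e" and L: "0 < L" "2 * B\<^sup>2 * L \<le> real m * e\<^sup>2"
  shows "ok (exec X D sample_loop s) (real m * (4 + max 0 \<tau>) + 2)
     (\<lambda>s'. same {''x'', ''j''} {''acc''} s s' \<and> narr s' = narr s \<and> rarr s' = rarr s)
     (\<lambda>s'. of_bool (\<bar>rvar s' ''acc'' / real m - \<Delta>\<bar> > e)) (ennreal (2 * exp (- L)))"
proof -
  \<comment> \<open>\<open>\<Psi> \<sigma>\<close> is the exponential supermartingale for the upper (\<open>\<sigma> = 1\<close>) or lower (\<open>\<sigma> = -1\<close>)
    tail.  The choice of \<open>l\<close> also covers \<open>B = 0\<close>; if \<open>m = 0\<close>, then \<open>B = 0\<close>, and the mean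
    \<open>acc / 0 = 0\<close> is correct.\<close>
  define Inv where "Inv = (\<lambda>j s'. j \<le> m \<and> nvar s' ''j'' = j \<and> same {''x'', ''j''} {''acc''} s s' \<and>
    narr s' = narr s \<and> rarr s' = rarr s)"
  define \<mu> where "\<mu> = (\<lambda>x. d x - \<Delta>)"
  define l where "l = 2 * L / (m * e)"
  define w where "w = exp (l\<^sup>2 * B\<^sup>2 / 2)"
  define \<Psi> where "\<Psi> = (\<lambda>\<sigma> j (s' :: memory). w ^ (m - j) * exp (- (l * m * e)) * exp (l * (\<sigma> * (rvar s' ''acc'' - j * \<Delta>))))"
  define \<Phi> where "\<Phi> = (\<lambda>j s'. if m = 0 then 0 else ennreal (\<Psi> 1 j s') + ennreal (\<Psi> (-1) j s'))"
  have vars: "nvar s' ''a'' = a" "nvar s' ''i'' = i" "nvar s' ''m'' = m" "nvar s' ''n'' = nvar s ''n''"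
     "nvar s' ''b'' = nvar s ''b''" "nvar s' ''S'' = nvar s ''S''"
    if "same {''x'', ''j''} {''acc''} s s'" for s'
    using same_nvar[OF that] by (simp_all add: a_def i_def m_def)
  have step: "(\<integral>\<^sup>+ x. ennreal (exp (l * (\<sigma> * \<mu> x))) \<partial>measure_pmf (trans X a i)) \<le> ennreal w"
    if "\<sigma> = 1 \<or> \<sigma> = -1" "0 < m" for \<sigma> :: real
  proof -
    have "0 < l" using L e that by (simp add: l_def)
    with nn_integral_exp_pmf_le[of l "trans X a i" "\<lambda>x. \<sigma> * d x" B] d that show ?thesis
      by (auto simp: \<mu>_def \<Delta>_def w_def algebra_simps)
  qed
  have "ok (exec X D sample_loop s) (real m * (4 + max 0 \<tau>) + 2) (Inv m) (\<Phi> m) (\<Phi> 0 s)"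
    unfolding sample_loop_def
  proof (rule ok_For[where T = "\<lambda>_. 2 + max 0 \<tau>"])
    fix j s' assume j: "j < m" and inv: "Inv j s'"
    note inv' = inv[unfolded Inv_def]
    have [simp]: "nvar s' ''a'' = a" "nvar s' ''i'' = i" "nvar s' ''n'' = nvar s ''n''"
        "nvar s' ''b'' = nvar s ''b''" "nvar s' ''S'' = nvar s ''S''" "rarr s' = rarr s" "narr s' = narr s"
        "nvar s' ''j'' = j"
      using inv' vars by blast+
    show "ok (exec X D (Seq (Sample ''x'' (NVar ''a'') (NVar ''i''))
          (RSet ''acc'' (RAdd (RVar ''acc'')
             (RSub (vcell (NVar ''n'') (NVar ''x'')) (vcell (NVar ''b'') (NVar ''x'')))))) s')
       (2 + max 0 \<tau>) (\<lambda>s'. nvar s' ''j'' = j \<and> Inv (Suc j) (set_nvar ''j'' (Suc j) s'))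
           (\<lambda>s'. \<Phi> (Suc j) (set_nvar ''j'' (Suc j) s')) (\<Phi> j s')"
    proof (rule ok_Seq[where Ta = "1 + max 0 \<tau>" and Tb = 1 and
          Wa = "\<lambda>s''. \<exists>x. s'' = set_nvar ''x'' x s'"
          and \<Phi>a = "\<lambda>s''. \<Phi> (Suc j) (s''\<lparr>rvar := (rvar s'')(''acc'' := rvar s'' ''acc'' + d (nvar s'' ''x''))\<rparr>)"])
      have "\<Psi> \<sigma> (Suc j) (s'\<lparr>nvar := (nvar s')(''x'' := x), rvar := (rvar s')(''acc'' := rvar s' ''acc'' + d x)\<rparr>)
          = w ^ (m - Suc j) * exp (- (l * m * e)) * exp (l * (\<sigma> * (rvar s' ''acc'' - j * \<Delta>))) * exp (l * (\<sigma> * \<mu> x))"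
        for \<sigma> x
        by (simp add: \<Psi>_def \<mu>_def algebra_simps flip: exp_add)
      note \<Psi>_step = this
      \<comment> \<open>The new sample is drawn from \<open>trans X a i\<close> whatever the past
        was, so the past factors out as \<open>?K\<close>; the moment bound of the new sample is
        paid with one of the \<open>m - j\<close> factors \<open>w\<close>.\<close>
      have le: "(\<integral>\<^sup>+ x. ennreal (\<Psi> \<sigma> (Suc j) (s'\<lparr>nvar := (nvar s')(''x'' := x), rvar := (rvar s')(''acc'' := rvar s' ''acc'' + d x)\<rparr>))
             \<partial>measure_pmf (trans X a i)) \<le> ennreal (\<Psi> \<sigma> j s')"
        if "\<sigma> = 1 \<or> \<sigma> = -1" for \<sigma>
      proof -
        let ?K = "w ^ (m - Suc j) * exp (- (l * m * e)) * exp (l * (\<sigma> * (rvar s' ''acc'' - j * \<Delta>)))"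
        have K: "0 \<le> ?K" by (simp add: w_def)
        have "(\<integral>\<^sup>+ x. ennreal (\<Psi> \<sigma> (Suc j) (s'\<lparr>nvar := (nvar s')(''x'' := x), rvar := (rvar s')(''acc'' := rvar s' ''acc'' + d x)\<rparr>))
             \<partial>measure_pmf (trans X a i)) =
            ennreal ?K * (\<integral>\<^sup>+ x. ennreal (exp (l * (\<sigma> * \<mu> x))) \<partial>measure_pmf (trans X a i))"
          unfolding \<Psi>_step by (subst ennreal_mult[OF K]) (auto simp: nn_integral_cmult)
        also have "\<dots> \<le> ennreal ?K * ennreal w"
          using j by (intro mult_left_mono step that) auto
        also have "\<dots> = ennreal (?K * w)"
          using K by (simp add: ennreal_mult w_def)
        also have "?K * w = \<Psi> \<sigma> j s'"
          using j by (simp add: \<Psi>_def Suc_diff_Suc[symmetric])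
        finally show ?thesis .
      qed
      show "ok (exec X D (Sample ''x'' (NVar ''a'') (NVar ''i'')) s') (1 + max 0 \<tau>) (\<lambda>s''. \<exists>x. s'' = set_nvar ''x'' x s')
          (\<lambda>s''. \<Phi> (Suc j) (s''\<lparr>rvar := (rvar s'')(''acc'' := rvar s'' ''acc'' + d (nvar s'' ''x''))\<rparr>)) (\<Phi> j s')"
      proof (rule ok_Sample[OF smp(1)])
        have "m \<noteq> 0" using j by simp
        show "(\<integral>\<^sup>+ x. \<Phi> (Suc j) ((set_nvar ''x'' x s')\<lparr>rvar := (rvar (set_nvar ''x'' x s'))(''acc'' :=
             rvar (set_nvar ''x'' x s') ''acc'' + d (nvar (set_nvar ''x'' x s') ''x''))\<rparr>)
             \<partial>measure_pmf (trans X (nval s' (NVar ''a'')) (nval s' (NVar ''i'')))) \<le> \<Phi> j s'"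
          using add_mono[OF le[of 1] le[of "-1"]] \<open>m \<noteq> 0\<close> by (simp add: \<Phi>_def nn_integral_add)
      qed (use smp in auto)
      fix s'' assume "\<exists>x. s'' = set_nvar ''x'' x s'"
      then obtain x where s'': "s'' = set_nvar ''x'' x s'" ..
      show "ok (exec X D (RSet ''acc'' (RAdd (RVar ''acc'')
             (RSub (vcell (NVar ''n'') (NVar ''x'')) (vcell (NVar ''b'') (NVar ''x''))))) s'') 1
           (\<lambda>s'. nvar s' ''j'' = j \<and> Inv (Suc j) (set_nvar ''j'' (Suc j) s'))
           (\<lambda>s'. \<Phi> (Suc j) (set_nvar ''j'' (Suc j) s'))
           (\<Phi> (Suc j) (s''\<lparr>rvar := (rvar s'')(''acc'' := rvar s'' ''acc'' + d (nvar s'' ''x''))\<rparr>))"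
        unfolding exec.simps
      proof (rule ok_return)
        have "same {''x'', ''j''} {''acc''} s s'" using inv' by blast
        then show "nvar (s''\<lparr>rvar := (rvar s'')(''acc'' := rval X s'' (RAdd (RVar ''acc'')
             (RSub (vcell (NVar ''n'') (NVar ''x'')) (vcell (NVar ''b'') (NVar ''x'')))))\<rparr>) ''j'' = j \<and>
           Inv (Suc j) (set_nvar ''j'' (Suc j) (s''\<lparr>rvar := (rvar s'')(''acc'' := rval X s'' (RAdd (RVar ''acc'')
             (RSub (vcell (NVar ''n'') (NVar ''x'')) (vcell (NVar ''b'') (NVar ''x'')))))\<rparr>))"
          using j by (simp add: s'' Inv_def same_def)
      qed (simp_all add: s'' d_def \<Phi>_def \<Psi>_def)
    qed simp
  next
    show "Inv 0 (set_nvar ''j'' 0 s)" by (simp add: Inv_def same_def eq_off_def)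
    show "\<Phi> 0 (set_nvar ''j'' 0 s) \<le> \<Phi> 0 s" by (simp add: \<Phi>_def \<Psi>_def)
    show "nvar s' ''j'' = j \<and> nval s' (NVar ''m'') = m" if "Inv j s'" for j s'
      using that vars by (simp add: Inv_def)
  qed (simp add: algebra_simps)
  then show ?thesis
  proof (rule ok_mono)
    fix s' assume "Inv m s'"
    then show "same {''x'', ''j''} {''acc''} s s' \<and> narr s' = narr s \<and> rarr s' = rarr s"
      by (simp add: Inv_def)
  next
    show "\<Phi> 0 s \<le> ennreal (2 * exp (- L))"
    proof (cases "m = 0")
      case False
      \<comment> \<open>With this \<open>l\<close> the second term is \<open>2 L\<close>, and the
        assumption on \<open>m\<close> bounds the first by \<open>L\<close>. When that assumption is
        tight and \<open>B \<noteq> 0\<close>, \<open>l\<close> equals the usual optimal choice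
        \<open>e / B\<^sup>2\<close>.\<close>
      have "m * (l\<^sup>2 * B\<^sup>2 / 2) - l * m * e \<le> - L"
      proof -
        have "m * (l\<^sup>2 * B\<^sup>2 / 2) = L * (2 * B\<^sup>2 * L) / (m * e\<^sup>2)"
          using False e by (simp add: l_def power2_eq_square field_simps)
        also have "\<dots> \<le> L * (m * e\<^sup>2) / (m * e\<^sup>2)"
          using L by (intro divide_right_mono mult_left_mono) auto
        also have "\<dots> = L" using False e by simp
        finally show ?thesis using False e by (simp add: l_def)
      qed
      then have "w ^ m * exp (- (l * m * e)) \<le> exp (- L)"
        unfolding w_def by (simp flip: exp_of_nat_mult exp_add)
      then have "ennreal (w ^ m * exp (- (l * m * e))) \<le> ennreal (exp (- L))"
        by (rule ennreal_leI)
      from add_mono[OF this this] have "\<Phi> 0 s \<le> ennreal (exp (- L)) + ennreal (exp (- L))"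
        using False by (simp add: \<Phi>_def \<Psi>_def acc)
      also have "\<dots> = ennreal (2 * exp (- L))"
        by (subst ennreal_plus[symmetric]) auto
      finally show ?thesis .
    qed (simp add: \<Phi>_def)
  next
    fix s' assume inv: "Inv m s'"
    show "of_bool (\<bar>rvar s' ''acc'' / real m - \<Delta>\<bar> > e) \<le> \<Phi> m s'"
    proof (cases "m = 0")
      case True
      then have "B = 0" using L by (simp add: mult_le_0_iff)
      then have "\<And>x. x \<in> set_pmf (trans X a i) \<Longrightarrow> d x = 0" using d by force
      then have "\<Delta> = measure_pmf.expectation (trans X a i) (\<lambda>_. 0)"
        unfolding \<Delta>_def by (intro integral_cong_AE) (auto simp: AE_measure_pmf_iff)
      with True e show ?thesis by simp
    next
      case False
      show ?thesis
      proof (cases "\<bar>rvar s' ''acc'' / real m - \<Delta>\<bar> > e")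
        case True
        \<comment> \<open>The sign of the deviation selects the tail. Along it the exponent of
          \<open>\<Psi>\<close> is nonnegative at the end of the loop, so the potential dominates
          the indicator of the bad event, as in Markov's inequality.\<close>
        then obtain \<sigma> :: real where \<sigma>: "\<sigma> = 1 \<or> \<sigma> = -1" "\<sigma> * (rvar s' ''acc'' / m - \<Delta>) > e"
          by (cases "rvar s' ''acc'' / real m - \<Delta> > 0") force+
        then have "m * (\<sigma> * (rvar s' ''acc'' / m - \<Delta>)) > m * e"
          using False by simp
        also have "m * (\<sigma> * (rvar s' ''acc'' / m - \<Delta>)) = \<sigma> * (rvar s' ''acc'' - m * \<Delta>)"
          using False by (simp add: field_simps)
        finally have "l * (m * e) \<le> l * (\<sigma> * (rvar s' ''acc'' - m * \<Delta>))"
          using L e by (intro mult_left_mono) (auto simp: l_def)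
        then have "1 \<le> \<Psi> \<sigma> m s'"
          by (simp add: \<Psi>_def mult.assoc flip: exp_add)
        then have "1 \<le> ennreal (\<Psi> \<sigma> m s')" by simp
        also have "\<dots> \<le> \<Phi> m s'" using \<sigma> False by (auto simp: \<Phi>_def)
        finally show ?thesis by simp
      qed simp
    qed
  qed simp_all
qed

section \<open>Value iteration\<close>

definition backup :: "mdp \<Rightarrow> (nat \<Rightarrow> real) \<Rightarrow> nat \<Rightarrow> nat \<Rightarrow> real" where
  "backup X f a i = reward X a i + measure_pmf.expectation (trans X a i) f"

abbreviation off_cell :: nexp where
  "off_cell \<equiv> NAdd (NMul (NVar ''a'') (NVar ''S'')) (NVar ''i'')"

abbreviation update_best :: com where
  "update_best \<equiv> Seq (RSet ''acc'' (RAdd (RAdd (RewardE (NVar ''a'') (NVar ''i''))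
              (RArr ''off'' off_cell))
              (RDiv (RVar ''acc'') (OfNat (NVar ''m'')))))
          (If (RLess (RVar ''best'') (RVar ''acc''))
              (Seq (RSet ''best'' (RVar ''acc'')) (NSet ''arg'' (NVar ''a'')))
              Skip)"

definition action_loop :: com where
  "action_loop = For ''a'' (NVar ''A'')
     (Seq (RSet ''acc'' (OfNat (NLit 0)))
     (Seq sample_loop
     update_best))"

text \<open>The last assumption is the sample size that Hoeffding's bound requires for values in the
  range \<open>k M\<close>, accuracy \<open>e\<close> and failure probability
  \<open>2 exp (- L)\<close>.\<close>

locale sampled_iteration =
  fixes X :: mdp and D :: sampler and \<tau> M e L :: real and k m :: nat
  assumes mdp: "finite_horizon_mdp X M" and smp: "valid_sampler X \<tau> D"
    and e: "0 < e" and L: "0 < L" and m: "2 * (real k * M)\<^sup>2 * L \<le> real m * e\<^sup>2"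
begin

abbreviation "S \<equiv> n_states X"
abbreviation "A \<equiv> n_actions X"
abbreviation "H \<equiv> horizon X"

lemma pos: "0 < S" "0 < A" "0 < H" "0 < M"
  using mdp by (auto simp: finite_horizon_mdp_def)

lemma set_trans: "a < A \<Longrightarrow> i < S \<Longrightarrow> j \<in> set_pmf (trans X a i) \<Longrightarrow> j < S"
  using mdp by (auto simp: finite_horizon_mdp_def)

lemma reward_bound: "a < A \<Longrightarrow> i < S \<Longrightarrow> \<bar>reward X a i\<bar> \<le> M"
  using mdp by (fastforce simp: finite_horizon_mdp_def)

lemma integrable_trans: "a < A \<Longrightarrow> i < S \<Longrightarrow> integrable (measure_pmf (trans X a i)) (f :: nat \<Rightarrow> real)"
  by (rule integrable_measure_pmf_finite, rule finite_subset[of _ "{..<S}"]) (use set_trans in blast)+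

lemma backup_cong: "a < A \<Longrightarrow> i < S \<Longrightarrow> (\<And>j. j < S \<Longrightarrow> f j = g j) \<Longrightarrow> backup X f a i = backup X g a i"
  unfolding backup_def
  by (auto intro!: integral_cong_AE simp: AE_measure_pmf_iff set_trans)

definition env :: "memory \<Rightarrow> bool" where
  "env s \<longleftrightarrow> nvar s ''S'' = S \<and> nvar s ''A'' = A \<and> nvar s ''H'' = H \<and>
     nvar s ''k'' = k \<and> nvar s ''m'' = m \<and> rvar s ''M'' = M"

definition row :: "memory \<Rightarrow> nat \<Rightarrow> nat \<Rightarrow> real" where
  "row s n i = rarr s ''v'' (n * S + i)"

definition offsets :: "nat \<Rightarrow> memory \<Rightarrow> bool" where
  "offsets b s \<longleftrightarrow> (\<forall>a<A. \<forall>i<S.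
     rarr s ''off'' (a * S + i) = measure_pmf.expectation (trans X a i) (row s b))"

text \<open>The state of the computation when row \<open>n\<close> is complete and
  \<open>''off''\<close> holds the exact expectations of row \<open>b\<close>. Allowing
  \<open>n = b + k\<close> means that \<open>k + 1\<close> steps share one exact
  computation.\<close>

definition block :: "nat \<Rightarrow> nat \<Rightarrow> memory \<Rightarrow> bool" where
  "block n b s \<longleftrightarrow> env s \<and> nvar s ''n'' = n \<and> nvar s ''b'' = b \<and> b \<le> n \<and> n \<le> b + k \<and>
     (\<forall>n'<n. \<forall>i<S. \<bar>row s (Suc n') i - row s n' i\<bar> \<le> M) \<and> offsets b s"

lemma block_same:
  assumes "block n b s" "same NV RV s s'" "rarr s' = rarr s"
    and "{''S'', ''A'', ''H'', ''k'', ''m'', ''n'', ''b''} \<inter> NV = {}" "''M'' \<notin> RV"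
  shows "block n b s'"
proof -
  have "row s' = row s" using assms(3) by (simp add: row_def fun_eq_iff)
  then show ?thesis
    using assms unfolding block_def env_def offsets_def same_def eq_off_def by auto
qed

text \<open>Telescoping over at most \<open>k\<close> clamped steps. Without the clamp, estimation
  errors could enlarge the range of the sampled function.\<close>

lemma block_diff:
  assumes "block n b s" "i < S"
  shows "\<bar>row s n i - row s b i\<bar> \<le> real k * M"
proof -
  have "\<bar>row s (b + j) i - row s b i\<bar> \<le> real j * M" if "b + j \<le> n" for j
    using that
  proof (induction j)
    case (Suc j)
    then have "\<bar>row s (Suc (b + j)) i - row s (b + j) i\<bar> \<le> M"
      using assms by (auto simp: block_def)
    with Suc show ?case by (simp add: algebra_simps)
  qed simp
  from this[of "n - b"] have "\<bar>row s n i - row s b i\<bar> \<le> real (n - b) * M"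
    using assms by (auto simp: block_def)
  also have "\<dots> \<le> real k * M"
    using assms pos by (intro mult_right_mono) (auto simp: block_def)
  finally show ?thesis .
qed

definition sample_time :: real where
  "sample_time = real m * (4 + max 0 \<tau>)"

definition estimate :: "memory \<Rightarrow> nat \<Rightarrow> nat \<Rightarrow> real \<Rightarrow> real" where
  "estimate s a i x = reward X a i + rarr s ''off'' (a * S + i) + x / real m"

text \<open>By linearity the exact expectation of row \<open>b\<close> cancels, so the error of the
  estimate is the error of the sample mean of \<open>row s n - row s b\<close>. The stored offset
  acts as a control variate.\<close>

lemma ok_sample_loop_block:
  assumes blk: "block n b s" and ai: "nvar s ''a'' < A" "nvar s ''i'' < S" and acc: "rvar s ''acc'' = 0"
  shows "ok (exec X D sample_loop s) (sample_time + 2)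
     (\<lambda>s'. same {''x'', ''j''} {''acc''} s s' \<and> narr s' = narr s \<and> rarr s' = rarr s)
     (\<lambda>s'. of_bool (\<bar>estimate s (nvar s ''a'') (nvar s ''i'') (rvar s' ''acc'')
         - backup X (row s n) (nvar s ''a'') (nvar s ''i'')\<bar> > e)) (ennreal (2 * exp (- L)))"
proof -
  let ?a = "nvar s ''a''" and ?i = "nvar s ''i''"
  have v: "nvar s ''S'' = S" "nvar s ''n'' = n" "nvar s ''b'' = b" "nvar s ''m'' = m"
    using blk by (auto simp: block_def env_def)
  have est: "estimate s ?a ?i x - backup X (row s n) ?a ?i =
      x / m - measure_pmf.expectation (trans X ?a ?i) (\<lambda>j. row s n j - row s b j)" for x
    using blk ai integrable_trans[OF ai]
    by (simp add: estimate_def backup_def block_def offsets_def)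
  have d: "\<bar>row s n j - row s b j\<bar> \<le> real k * M" if "j \<in> set_pmf (trans X ?a ?i)" for j
    using block_diff[OF blk] set_trans[OF ai that] by simp
  show ?thesis
    unfolding est sample_time_def
    by (rule ok_sample_loop[OF smp ai acc, of "real k * M" e L, unfolded v, folded row_def, OF d e L m])
qed

text \<open>A running maximum that starts from the pair \<open>b0\<close>, \<open>p0\<close>. The
  start is no estimate, so the upper bound on the result is conditional on the same bound for
  \<open>b0\<close> and \<open>p0\<close>: each update replaces the pair by an estimate within
  \<open>e\<close> of its backup, and otherwise the bound is inherited. The condition is discharged
  only in the deterministic analysis.\<close>

lemma ok_action_loop:
  fixes n b i p0 :: nat and b0 :: real
  assumes blk: "block n b s" and i: "nvar s ''i'' = i" "i < S" and p0: "nvar s ''arg'' = p0" "p0 < A"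
    and b0: "rvar s ''best'' = b0"
  shows "ok (exec X D action_loop s) (real A * (sample_time + 9) + 2)
     (\<lambda>s'. same {''x'', ''j'', ''a'', ''arg''} {''acc'', ''best''} s s' \<and> narr s' = narr s \<and> rarr s' = rarr s \<and>
        nvar s' ''arg'' < A \<and> b0 \<le> rvar s' ''best'')
     (\<lambda>s'. of_bool (\<not> ((b0 \<le> backup X (row s n) p0 i + e \<longrightarrow>
             rvar s' ''best'' \<le> backup X (row s n) (nvar s' ''arg'') i + e) \<and>
         (\<forall>a<A. backup X (row s n) a i - e \<le> rvar s' ''best''))))
     (of_nat A * ennreal (2 * exp (- L)))"
proof -
  let ?NV = "{''x'', ''j'', ''a'', ''arg''}" and ?RV = "{''acc'', ''best''}"
  let ?T = "backup X (row s n)"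
  define Inv where "Inv = (\<lambda>a s'. a \<le> A \<and> nvar s' ''a'' = a \<and> same ?NV ?RV s s' \<and>
    narr s' = narr s \<and> rarr s' = rarr s \<and> nvar s' ''arg'' < A \<and> b0 \<le> rvar s' ''best'')"
  define g where "g = (\<lambda>c (s' :: memory). (b0 \<le> ?T p0 i + e \<longrightarrow> rvar s' ''best'' \<le> ?T (nvar s' ''arg'') i + e) \<and>
         (\<forall>a<c. ?T a i - e \<le> rvar s' ''best''))"
  have "ok (exec X D action_loop s) (real A * (sample_time + 9) + 2) (Inv A)
     (\<lambda>s'. of_bool (\<not> g A s')) (of_nat A * ennreal (2 * exp (- L)))"
    unfolding action_loop_def
  proof (rule ok_For_fail[where T = "\<lambda>_. sample_time + 7"])
    show "Inv 0 (set_nvar ''a'' 0 s)"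
      using p0 b0 pos by (simp add: Inv_def same_def)
    show "g 0 (set_nvar ''a'' 0 s)"
      using p0 b0 by (simp add: g_def)
    show "nvar s' ''a'' = a \<and> nval s' (NVar ''A'') = A" if "Inv a s'" for a s'
      using that blk same_nvar[of ?NV ?RV s s' "''A''"] by (simp add: Inv_def block_def env_def)
    show "(\<Sum>j<A. sample_time + 7 + 2) + 2 \<le> real A * (sample_time + 9) + 2"
      by (simp add: algebra_simps)
  next
    fix a s1 assume a: "a < A" and inv: "Inv a s1"
    let ?s2 = "s1\<lparr>rvar := (rvar s1)(''acc'' := 0)\<rparr>"
    have same1: "same ?NV ?RV s s1" and arr1: "narr s1 = narr s" "rarr s1 = rarr s" "nvar s1 ''a'' = a"
      and arg1: "nvar s1 ''arg'' < A" "b0 \<le> rvar s1 ''best''"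
      using inv by (auto simp: Inv_def)
    have blk2: "block n b ?s2"
      by (rule block_same[OF blk, of ?NV ?RV]) (use same1 arr1 in \<open>auto simp: same_def\<close>)
    have i2: "nvar s1 ''i'' = i"
      using same_nvar[OF same1, of "''i''"] i by simp
    have row2: "row ?s2 = row s"
      using arr1 by (simp add: row_def fun_eq_iff)
    have "ok (exec X D (Seq sample_loop
         update_best) ?s2) (sample_time + 6)
         (\<lambda>s'. nvar s' ''a'' = a \<and> Inv (Suc a) (set_nvar ''a'' (Suc a) s'))
         (\<lambda>s'. of_bool (g a s1 \<and> \<not> g (Suc a) (set_nvar ''a'' (Suc a) s'))) (ennreal (2 * exp (- L)))"
    proof (rule ok_Seq[OF ok_sample_loop_block[OF blk2]])
      show "nvar ?s2 ''a'' < A" "nvar ?s2 ''i'' < S" "rvar ?s2 ''acc'' = 0"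
        using arr1 a i2 i by simp_all
      fix s3 assume "same {''x'', ''j''} {''acc''} ?s2 s3 \<and> narr s3 = narr ?s2 \<and> rarr s3 = rarr ?s2"
      then have same23: "same {''x'', ''j''} {''acc''} ?s2 s3" and arr3: "narr s3 = narr s" "rarr s3 = rarr s"
        using arr1 by auto
      have "same ?NV ?RV s ?s2" using same1 by (simp add: same_def)
      from same_trans[OF this same23] have same3: "same ?NV ?RV s s3" by auto
      have vars3: "nvar s3 ''a'' = a" "nvar s3 ''i'' = i" "nvar s3 ''S'' = S" "nvar s3 ''m'' = m"
          "nvar s3 ''arg'' = nvar s1 ''arg''" "rvar s3 ''best'' = rvar s1 ''best''"
        using same_nvar[OF same23] same_rvar[OF same23] arr1 i2 blk2 by (simp_all add: block_def env_def)
      let ?q = "estimate s a i (rvar s3 ''acc'')"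
      let ?s4 = "s3\<lparr>rvar := (rvar s3)(''acc'' := ?q)\<rparr>"
      have good: "g (Suc a) (set_nvar ''a'' (Suc a) s')"
        if "g a s1" "\<bar>?q - ?T a i\<bar> \<le> e"
          and "if rvar s1 ''best'' < ?q then rvar s' ''best'' = ?q \<and> nvar s' ''arg'' = a
               else rvar s' ''best'' = rvar s1 ''best'' \<and> nvar s' ''arg'' = nvar s1 ''arg''" for s'
        using that by (auto simp: g_def less_Suc_eq split: if_splits; force)
      let ?Phi = "of_bool (\<bar>estimate ?s2 (nvar ?s2 ''a'') (nvar ?s2 ''i'') (rvar s3 ''acc'')
         - backup X (row ?s2 n) (nvar ?s2 ''a'') (nvar ?s2 ''i'')\<bar> > e) :: ennreal"
      have Phi: "?Phi = of_bool (\<bar>?q - ?T a i\<bar> > e)"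
        using row2 arr1 i2 by (simp add: estimate_def)
      show "ok (exec X D update_best s3) 4
         (\<lambda>s'. nvar s' ''a'' = a \<and> Inv (Suc a) (set_nvar ''a'' (Suc a) s'))
         (\<lambda>s'. of_bool (g a s1 \<and> \<not> g (Suc a) (set_nvar ''a'' (Suc a) s'))) ?Phi"
        unfolding Phi
      proof (rule ok_Seq_return)
        show "exec X D (RSet ''acc'' (RAdd (RAdd (RewardE (NVar ''a'') (NVar ''i''))
                  (RArr ''off'' off_cell))
                  (RDiv (RVar ''acc'') (OfNat (NVar ''m''))))) s3 = return_spmf (?s4, 1)"
          by (simp add: vars3 arr3 estimate_def)
        show "ok (exec X D (If (RLess (RVar ''best'') (RVar ''acc''))
                  (Seq (RSet ''best'' (RVar ''acc'')) (NSet ''arg'' (NVar ''a'')))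
                  Skip) ?s4) 3
         (\<lambda>s'. nvar s' ''a'' = a \<and> Inv (Suc a) (set_nvar ''a'' (Suc a) s'))
         (\<lambda>s'. of_bool (g a s1 \<and> \<not> g (Suc a) (set_nvar ''a'' (Suc a) s'))) (of_bool (\<bar>?q - ?T a i\<bar> > e))"
        proof (rule ok_If[where T = 2])
          assume "bval X ?s4 (RLess (RVar ''best'') (RVar ''acc''))"
          then have less: "rvar s1 ''best'' < ?q" by (simp add: vars3)
          let ?s5 = "?s4\<lparr>rvar := (rvar ?s4)(''best'' := ?q), nvar := (nvar ?s4)(''arg'' := a)\<rparr>"
          have "exec X D (Seq (RSet ''best'' (RVar ''acc'')) (NSet ''arg'' (NVar ''a''))) ?s4 = return_spmf (?s5, 2)"
            by (simp add: vars3)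
          moreover have "Inv (Suc a) (set_nvar ''a'' (Suc a) ?s5)"
            using less a arg1 same3 arr3 by (simp add: Inv_def same_def)
          moreover have "nvar ?s5 ''a'' = a" using vars3 by simp
          ultimately show "ok (exec X D (Seq (RSet ''best'' (RVar ''acc'')) (NSet ''arg'' (NVar ''a''))) ?s4) 2
               (\<lambda>s'. nvar s' ''a'' = a \<and> Inv (Suc a) (set_nvar ''a'' (Suc a) s'))
               (\<lambda>s'. of_bool (g a s1 \<and> \<not> g (Suc a) (set_nvar ''a'' (Suc a) s'))) (of_bool (\<bar>?q - ?T a i\<bar> > e))"
            using good[of ?s5] less by (auto intro!: ok_return simp: of_bool_def)
        next
          assume "\<not> bval X ?s4 (RLess (RVar ''best'') (RVar ''acc''))"
          then have less: "\<not> rvar s1 ''best'' < ?q" by (simp add: vars3)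
          have "Inv (Suc a) (set_nvar ''a'' (Suc a) ?s4)"
            using a arg1 same3 arr3 vars3 by (simp add: Inv_def same_def)
          moreover have "nvar ?s4 ''a'' = a" using vars3 by simp
          ultimately show "ok (exec X D Skip ?s4) 2
               (\<lambda>s'. nvar s' ''a'' = a \<and> Inv (Suc a) (set_nvar ''a'' (Suc a) s'))
               (\<lambda>s'. of_bool (g a s1 \<and> \<not> g (Suc a) (set_nvar ''a'' (Suc a) s'))) (of_bool (\<bar>?q - ?T a i\<bar> > e))"
            using good[of ?s4] less vars3 by (auto intro!: ok_return simp: of_bool_def)
        qed simp
      qed simp
    qed simp
    then show "ok (exec X D (Seq (RSet ''acc'' (OfNat (NLit 0)))
        (Seq sample_loop
         update_best)) s1) (sample_time + 7)
         (\<lambda>s'. nvar s' ''a'' = a \<and> Inv (Suc a) (set_nvar ''a'' (Suc a) s'))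
         (\<lambda>s'. of_bool (g a s1 \<and> \<not> g (Suc a) (set_nvar ''a'' (Suc a) s'))) (ennreal (2 * exp (- L)))"
      by (rule ok_Seq_return[where t = 1, rotated]) simp_all
  qed
  then show ?thesis
    by (rule ok_mono) (auto simp: Inv_def g_def)
qed

end

section \<open>One step of value iteration over all states, and the exact expectations\<close>

abbreviation picell :: "nexp \<Rightarrow> nexp" where
  "picell h \<equiv> NAdd (NMul (NSub (NVar ''H'') h) (NVar ''S'')) (NVar ''i'')"

abbreviation clamp_best :: com where
  "clamp_best \<equiv> If (RLess (RAdd (vcell (NVar ''n'') (NVar ''i'')) (RVar ''M'')) (RVar ''best''))
              (RSet ''best'' (RAdd (vcell (NVar ''n'') (NVar ''i'')) (RVar ''M''))) Skip"

abbreviation store_best :: com where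
  "store_best \<equiv> Seq (RStore ''v'' (NAdd (NMul (NAdd (NVar ''n'') (NLit 1)) (NVar ''S'')) (NVar ''i'')) (RVar ''best''))
          (NStore ''pi'' (picell (NAdd (NVar ''n'') (NLit 1))) (NVar ''arg''))"

text \<open>
  Row \<open>n\<close> of the array \<open>''v''\<close> holds the values with \<open>n\<close> steps to go, hence the actions chosen in
  step \<open>n\<close> belong to time \<open>H - (n + 1)\<close>.  Starting the maximization at \<open>v_n - M\<close> with the
  previous action implements the lower clamp.
\<close>
definition state_loop :: com where
  "state_loop = For ''i'' (NVar ''S'')
     (Seq (RSet ''best'' (RSub (vcell (NVar ''n'') (NVar ''i'')) (RVar ''M'')))
     (Seq (NSet ''arg'' (NArr ''pi'' (picell (NVar ''n''))))
     (Seq action_loop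
     (Seq clamp_best
     store_best))))"

abbreviation add_offset :: com where
  "add_offset \<equiv> RStore ''off'' off_cell
           (RAdd (RArr ''off'' off_cell)
              (RMul (TransE (NVar ''a'') (NVar ''i'') (NVar ''j'')) (vcell (NVar ''n'') (NVar ''j''))))"

definition offset_loop :: com where
  "offset_loop = For ''a'' (NVar ''A'') (For ''i'' (NVar ''S'')
     (Seq (RStore ''off'' off_cell (OfNat (NLit 0)))
     (For ''j'' (NVar ''S'')
        add_offset)))"

context sampled_iteration
begin

lemma expectation_cong:
  "a < A \<Longrightarrow> i < S \<Longrightarrow> (\<And>j. j < S \<Longrightarrow> f j = g j) \<Longrightarrow>
     measure_pmf.expectation (trans X a i) f = (measure_pmf.expectation (trans X a i) g :: real)"
  by (auto intro!: integral_cong_AE simp: AE_measure_pmf_iff set_trans)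

lemma expectation_sum:
  "a < A \<Longrightarrow> i < S \<Longrightarrow>
     measure_pmf.expectation (trans X a i) f = (\<Sum>j<S. pmf (trans X a i) j * (f j :: real))"
  by (subst integral_measure_pmf[where A = "{..<S}"]) (auto dest: set_trans)

lemma cell_less: "n' \<le> n \<Longrightarrow> i < S \<Longrightarrow> n' * S + i < Suc n * S"
  using mult_le_mono1[of n' n S] unfolding mult_Suc by linarith

text \<open>Rows up to \<open>n\<close> fill the cells below \<open>Suc n * S\<close>, so the
  invariant survives while row \<open>Suc n\<close> is being written.\<close>

lemma block_cong:
  assumes "block n b s" "env s'" "nvar s' ''n'' = n" "nvar s' ''b'' = b"
    and "\<And>y. y < Suc n * S \<Longrightarrow> rarr s' ''v'' y = rarr s ''v'' y"
    and "rarr s' ''off'' = rarr s ''off''"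
  shows "block n b s'"
proof -
  have row: "row s' n' i = row s n' i" if "n' \<le> n" "i < S" for n' i
    using assms(5)[OF cell_less[OF that]] by (simp add: row_def)
  have "b \<le> n" using assms(1) by (simp add: block_def)
  have "measure_pmf.expectation (trans X a i) (row s' b) = measure_pmf.expectation (trans X a i) (row s b)"
    if "a < A" "i < S" for a i
    by (rule expectation_cong[OF that]) (use row \<open>b \<le> n\<close> in auto)
  then have "offsets b s'"
    using assms(1,6) by (simp add: block_def offsets_def)
  then show ?thesis
    using assms(1-4) row by (auto simp: block_def)
qed

text \<open>The deterministic certificate extracted from the random computation; once it holds for
  all steps and states, no probability is left. The premise of the first conjunct says that the
  inherited action attains the lower clamp up to \<open>e\<close>; the \<open>min\<close> in the
  second reflects the upper clamp.\<close>

definition step_ok :: "(nat \<Rightarrow> real) \<Rightarrow> (nat \<Rightarrow> nat) \<Rightarrow> nat \<Rightarrow> nat \<Rightarrow> bool" where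
  "step_ok v \<pi> n i \<longleftrightarrow>
     (v (n * S + i) - M \<le> backup X (\<lambda>j. v (n * S + j)) (\<pi> ((H - n) * S + i)) i + e \<longrightarrow>
        v (Suc n * S + i) \<le> backup X (\<lambda>j. v (n * S + j)) (\<pi> ((H - Suc n) * S + i)) i + e) \<and>
     (\<forall>a<A. min (backup X (\<lambda>j. v (n * S + j)) a i - e) (v (n * S + i) + M) \<le> v (Suc n * S + i))"

lemma step_ok_cong:
  assumes "i < S" "\<And>y. \<pi> y < A"
    and "\<And>y. y < Suc n * S \<Longrightarrow> v' y = v y" "v' (Suc n * S + i) = v (Suc n * S + i)"
    and "\<pi>' ((H - n) * S + i) = \<pi> ((H - n) * S + i)" "\<pi>' ((H - Suc n) * S + i) = \<pi> ((H - Suc n) * S + i)"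
  shows "step_ok v' \<pi>' n i \<longleftrightarrow> step_ok v \<pi> n i"
proof -
  have row: "v' (n * S + j) = v (n * S + j)" if "j < S" for j
    using assms(3) cell_less[of n n j] that by simp
  have bk: "backup X (\<lambda>j. v' (n * S + j)) a i = backup X (\<lambda>j. v (n * S + j)) a i" if "a < A" for a
    by (rule backup_cong[OF that \<open>i < S\<close>]) (use row in auto)
  show ?thesis
    unfolding step_ok_def assms(4-6) using assms(1,2) by (simp add: bk row)
qed

lemma ok_state_loop:
  fixes n b :: nat
  assumes blk: "block n b s" and n: "n < H" and pi: "\<And>y. narr s ''pi'' y < A"
  shows "ok (exec X D state_loop s) (real S * (real A * (sample_time + 9) + 10) + 2)
     (\<lambda>s'. same {''x'', ''j'', ''a'', ''arg'', ''i''} {''acc'', ''best''} s s' \<and>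
        rarr s' ''off'' = rarr s ''off'' \<and> (\<forall>y < Suc n * S. rarr s' ''v'' y = rarr s ''v'' y) \<and>
        (\<forall>y \<ge> (H - n) * S. narr s' ''pi'' y = narr s ''pi'' y) \<and> (\<forall>y. narr s' ''pi'' y < A) \<and>
        (\<forall>i<S. \<bar>row s' (Suc n) i - row s n i\<bar> \<le> M))
     (\<lambda>s'. of_bool (\<not> (\<forall>i<S. step_ok (rarr s' ''v'') (narr s' ''pi'') n i)))
     (of_nat S * (of_nat A * ennreal (2 * exp (- L))))"
proof -
  let ?NV = "{''x'', ''j'', ''a'', ''arg'', ''i''}" and ?RV = "{''acc'', ''best''}"
  define Inv where "Inv = (\<lambda>i s'. i \<le> S \<and> nvar s' ''i'' = i \<and> same ?NV ?RV s s' \<and>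
        rarr s' ''off'' = rarr s ''off'' \<and> (\<forall>y < Suc n * S. rarr s' ''v'' y = rarr s ''v'' y) \<and>
        (\<forall>y \<ge> (H - n) * S. narr s' ''pi'' y = narr s ''pi'' y) \<and> (\<forall>y. narr s' ''pi'' y < A) \<and>
        (\<forall>i'<i. \<bar>row s' (Suc n) i' - row s n i'\<bar> \<le> M))"
  define g where "g = (\<lambda>c (s' :: memory). \<forall>i<c. step_ok (rarr s' ''v'') (narr s' ''pi'') n i)"
  have env: "env s'" "nvar s' ''n'' = n" "nvar s' ''b'' = b" if "same ?NV ?RV s s'" for s'
    using blk same_nvar[OF that] same_rvar[OF that] by (simp_all add: block_def env_def)
  have "ok (exec X D state_loop s) (real S * (real A * (sample_time + 9) + 10) + 2) (Inv S)
     (\<lambda>s'. of_bool (\<not> g S s')) (of_nat S * (of_nat A * ennreal (2 * exp (- L))))"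
    unfolding state_loop_def
  proof (rule ok_For_fail[where T = "\<lambda>_. real A * (sample_time + 9) + 8"])
    show "Inv 0 (set_nvar ''i'' 0 s)" "g 0 (set_nvar ''i'' 0 s)"
      using pi by (simp_all add: Inv_def same_def g_def)
    show "nvar s' ''i'' = i \<and> nval s' (NVar ''S'') = S" if "Inv i s'" for i s'
      using that env[of s'] by (simp add: Inv_def env_def)
    show "(\<Sum>i<S. real A * (sample_time + 9) + 8 + 2) + 2 \<le> real S * (real A * (sample_time + 9) + 10) + 2"
      by (simp add: algebra_simps)
  next
    fix i s1 assume i: "i < S" and inv: "Inv i s1"
    have same1: "same ?NV ?RV s s1" and i1: "nvar s1 ''i'' = i"
      and off1: "rarr s1 ''off'' = rarr s ''off''"
      and v1: "\<And>y. y < Suc n * S \<Longrightarrow> rarr s1 ''v'' y = rarr s ''v'' y"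
      and pi1: "\<And>y. y \<ge> (H - n) * S \<Longrightarrow> narr s1 ''pi'' y = narr s ''pi'' y" "\<And>y. narr s1 ''pi'' y < A"
      and diff1: "\<And>i'. i' < i \<Longrightarrow> \<bar>row s1 (Suc n) i' - row s n i'\<bar> \<le> M"
      using inv by (auto simp: Inv_def)
    \<comment> \<open>For \<open>n = 0\<close> the inherited action comes from the cells of time
      \<open>H\<close>, beyond the output. They keep their initial 0, a legal action; this is why
      all cells of \<open>''pi''\<close> are kept below \<open>A\<close>.\<close>
    define b0 p0 where "b0 = row s n i - M" and "p0 = narr s1 ''pi'' ((H - n) * S + i)"
    define s2 where "s2 = s1\<lparr>rvar := (rvar s1)(''best'' := b0), nvar := (nvar s1)(''arg'' := p0)\<rparr>"
    have env1: "nvar s1 ''S'' = S" "nvar s1 ''H'' = H" "nvar s1 ''n'' = n" "rvar s1 ''M'' = M"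
      using env[OF same1] by (simp_all add: env_def)
    have row1: "rarr s1 ''v'' (n * S + j) = row s n j" if "j < S" for j
      using v1[OF cell_less[OF order_refl that]] by (simp add: row_def)
    have same2: "same ?NV ?RV s s2" using same1 by (simp add: s2_def same_def)
    have blk2: "block n b s2"
      by (rule block_cong[OF blk env[OF same2]]) (use v1 off1 in \<open>simp_all add: s2_def\<close>)
    let ?rest = "Seq clamp_best
     store_best"
    let ?T = "backup X (row s n)"
    have bk: "backup X (row s2 n) a i = ?T a i" if "a < A" for a
      by (rule backup_cong[OF that i]) (use row1 in \<open>simp add: row_def s2_def\<close>)
    have "ok (exec X D (Seq action_loop ?rest) s2) (real A * (sample_time + 9) + 6)
           (\<lambda>s'. nvar s' ''i'' = i \<and> Inv (Suc i) (set_nvar ''i'' (Suc i) s'))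
           (\<lambda>s'. of_bool (g i s1 \<and> \<not> g (Suc i) (set_nvar ''i'' (Suc i) s')))
           (of_nat A * ennreal (2 * exp (- L)))"
    proof (rule ok_Seq[OF ok_action_loop[OF blk2]])
      show "nvar s2 ''i'' = i" "i < S" "nvar s2 ''arg'' = p0" "p0 < A" "rvar s2 ''best'' = b0"
        using i1 i pi1(2) by (simp_all add: s2_def p0_def)
      fix s3 assume "same {''x'', ''j'', ''a'', ''arg''} {''acc'', ''best''} s2 s3 \<and> narr s3 = narr s2 \<and>
        rarr s3 = rarr s2 \<and> nvar s3 ''arg'' < A \<and> b0 \<le> rvar s3 ''best''"
      then have same23: "same {''x'', ''j'', ''a'', ''arg''} {''acc'', ''best''} s2 s3"
        and arr3: "narr s3 = narr s1" "rarr s3 = rarr s1" and arg3: "nvar s3 ''arg'' < A"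
        and best3: "b0 \<le> rvar s3 ''best''"
        by (auto simp: s2_def)
      have same3: "same ?NV ?RV s s3" by (rule same_trans[OF same2 same23]) auto
      have vars3: "nvar s3 ''S'' = S" "nvar s3 ''H'' = H" "nvar s3 ''n'' = n" "rvar s3 ''M'' = M" "nvar s3 ''i'' = i"
        using env[OF same3] same_nvar[OF same23, of "''i''"] i1 by (simp_all add: env_def s2_def)
      define w where "w = min (rvar s3 ''best'') (row s n i + M)"
      let ?p = "nvar s3 ''arg''"
      define s4 where "s4 = s3\<lparr>rvar := (rvar s3)(''best'' := w)\<rparr>"
      define s5 where "s5 = s4\<lparr>rarr := (rarr s1)(''v'' := (rarr s1 ''v'')(Suc n * S + i := w)),
         narr := (narr s1)(''pi'' := (narr s1 ''pi'')((H - Suc n) * S + i := ?p))\<rparr>"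
      have "exec X D clamp_best s3 = return_spmf (s4, 2)"
        using row1[OF i] by (simp add: vars3 arr3 s4_def w_def min_def not_less)
      moreover have "exec X D store_best s4 = return_spmf (s5, 2)"
        by (simp add: vars3 arr3 s4_def s5_def)
      ultimately have ex: "exec X D ?rest s3 = return_spmf (s5, 4)"
        by simp
      have w: "\<bar>w - row s n i\<bar> \<le> M"
        using best3 pos by (auto simp: w_def b0_def abs_le_iff min_def)
      have arr5: "rarr s5 ''v'' y = (if y = Suc n * S + i then w else rarr s1 ''v'' y)"
          "narr s5 ''pi'' y = (if y = (H - Suc n) * S + i then ?p else narr s1 ''pi'' y)"
          "rarr s5 ''off'' = rarr s ''off''" "nvar s5 = nvar s3" for y
        using off1 by (simp_all add: s5_def s4_def)
      \<comment> \<open>The actions written now lie strictly below those of all later times, so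
        neither the inherited actions nor earlier certificates are disturbed.\<close>
      have H: "(H - Suc n) * S + i < (H - n) * S"
        using n i cell_less[of "H - Suc n" "H - Suc n" i] by (simp add: Suc_diff_Suc)
      have inv': "Inv (Suc i) (set_nvar ''i'' (Suc i) s5)"
      proof -
        have "same ?NV ?RV s (set_nvar ''i'' (Suc i) s5)"
          using same3 by (simp add: s5_def s4_def same_def)
        moreover have "\<forall>y < Suc n * S. rarr s5 ''v'' y = rarr s ''v'' y"
          using v1 by (simp add: arr5)
        moreover have "\<forall>y \<ge> (H - n) * S. narr s5 ''pi'' y = narr s ''pi'' y"
          using pi1 H by (auto simp: arr5)
        moreover have "\<forall>y. narr s5 ''pi'' y < A"
          using pi1(2) arg3 by (simp add: arr5)
        moreover have "\<forall>i' < Suc i. \<bar>row s5 (Suc n) i' - row s n i'\<bar> \<le> M"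
          using diff1 w unfolding row_def arr5(1) by (auto simp: less_Suc_eq)
        ultimately show ?thesis
          using i arr5(3) by (simp add: Inv_def row_def)
      qed
      have good: "g (Suc i) (set_nvar ''i'' (Suc i) s5)"
        if g: "g i s1"
          and best: "b0 \<le> ?T p0 i + e \<longrightarrow> rvar s3 ''best'' \<le> ?T ?p i + e"
            "\<forall>a<A. ?T a i - e \<le> rvar s3 ''best''"
      proof -
        have "step_ok (rarr s5 ''v'') (narr s5 ''pi'') n i'" if "i' < i" for i'
        proof (subst step_ok_cong[where v = "rarr s1 ''v''" and \<pi> = "narr s1 ''pi''"])
          show "step_ok (rarr s1 ''v'') (narr s1 ''pi'') n i'" using g that by (simp add: g_def)
          show "narr s5 ''pi'' ((H - n) * S + i') = narr s1 ''pi'' ((H - n) * S + i')"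
            using H by (simp add: arr5)
        qed (use that i pi1(2) in \<open>simp_all add: arr5\<close>)
        moreover have "step_ok (rarr s5 ''v'') (narr s5 ''pi'') n i"
        proof -
          have row5: "rarr s5 ''v'' (n * S + j) = row s n j" if "j < S" for j
            using row1[OF that] cell_less[OF order_refl that, of n] by (simp add: arr5)
          have bk5: "backup X (\<lambda>j. rarr s5 ''v'' (n * S + j)) a i = ?T a i" if "a < A" for a
            by (rule backup_cong[OF that i]) (rule row5)
          have "(H - n) * S + i \<noteq> (H - Suc n) * S + i" using H by linarith
          then have p5: "narr s5 ''pi'' ((H - n) * S + i) = p0" "narr s5 ''pi'' ((H - Suc n) * S + i) = ?p"
              "rarr s5 ''v'' (Suc n * S + i) = w"
            unfolding arr5 p0_def by (simp_all only: if_False if_True refl)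
          have "p0 < A" using pi1(2) by (simp add: p0_def)
          then show ?thesis
            unfolding step_ok_def p5 row5[OF i] using best arg3
            by (auto simp: bk5 b0_def w_def min_le_iff_disj)
        qed
        ultimately show ?thesis by (simp add: g_def less_Suc_eq)
      qed
      let ?Phi = "of_bool (\<not> ((b0 \<le> backup X (row s2 n) p0 i + e \<longrightarrow>
             rvar s3 ''best'' \<le> backup X (row s2 n) (nvar s3 ''arg'') i + e) \<and>
         (\<forall>a<A. backup X (row s2 n) a i - e \<le> rvar s3 ''best''))) :: ennreal"
      have "p0 < A" using pi1(2) by (simp add: p0_def)
      show "ok (exec X D ?rest s3) 4
           (\<lambda>s'. nvar s' ''i'' = i \<and> Inv (Suc i) (set_nvar ''i'' (Suc i) s'))
           (\<lambda>s'. of_bool (g i s1 \<and> \<not> g (Suc i) (set_nvar ''i'' (Suc i) s'))) ?Phi"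
        unfolding ex
      proof (rule ok_return)
        show "nvar s5 ''i'' = i \<and> Inv (Suc i) (set_nvar ''i'' (Suc i) s5)"
          using inv' vars3 by (simp add: arr5)
        show "of_bool (g i s1 \<and> \<not> g (Suc i) (set_nvar ''i'' (Suc i) s5)) \<le> ?Phi"
          using good \<open>p0 < A\<close> arg3 by (auto simp: bk of_bool_def)
      qed simp
    qed simp
    then have "ok (exec X D (Seq (NSet ''arg'' (NArr ''pi'' (picell (NVar ''n'')))) (Seq action_loop ?rest))
         (s1\<lparr>rvar := (rvar s1)(''best'' := b0)\<rparr>)) (real A * (sample_time + 9) + 7)
           (\<lambda>s'. nvar s' ''i'' = i \<and> Inv (Suc i) (set_nvar ''i'' (Suc i) s'))
           (\<lambda>s'. of_bool (g i s1 \<and> \<not> g (Suc i) (set_nvar ''i'' (Suc i) s')))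
           (of_nat A * ennreal (2 * exp (- L)))"
      by (rule ok_Seq_return[where t = 1, rotated]) (use i1 in \<open>simp_all add: s2_def p0_def env1\<close>)
    then show "ok (exec X D (Seq (RSet ''best'' (RSub (vcell (NVar ''n'') (NVar ''i'')) (RVar ''M'')))
         (Seq (NSet ''arg'' (NArr ''pi'' (picell (NVar ''n'')))) (Seq action_loop ?rest))) s1)
         (real A * (sample_time + 9) + 8)
           (\<lambda>s'. nvar s' ''i'' = i \<and> Inv (Suc i) (set_nvar ''i'' (Suc i) s'))
           (\<lambda>s'. of_bool (g i s1 \<and> \<not> g (Suc i) (set_nvar ''i'' (Suc i) s')))
           (of_nat A * ennreal (2 * exp (- L)))"
      by (rule ok_Seq_return[where t = 1, rotated]) (use i1 row1[OF i] in \<open>simp_all add: b0_def env1\<close>)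
  qed
  then show ?thesis
    by (rule ok_mono) (auto simp: Inv_def g_def)
qed

text \<open>The exact part of the work, quadratic in \<open>S\<close> and deterministic, hence
  postexpectation 0. The invariants of the three loops are nested: \<open>Ia\<close> for finished
  actions, \<open>Ii\<close> for finished states of the current action, \<open>Ij\<close> for the
  partial sum in the current cell.\<close>

lemma ok_offset_loop:
  assumes env: "env s" "nvar s ''n'' = n"
  shows "ok (exec X D offset_loop s) (real A * (real S * (3 * real S + 5) + 4) + 2)
     (\<lambda>s'. same {''a'', ''i'', ''j''} {} s s' \<and> narr s' = narr s \<and> rarr s' ''v'' = rarr s ''v'' \<and> offsets n s')
     (\<lambda>_. 0) 0"
proof -
  let ?NV = "{''a'', ''i'', ''j''}"
  let ?E = "\<lambda>a i. measure_pmf.expectation (trans X a i) (row s n)"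
  define base where "base = (\<lambda>s'. same ?NV {} s s' \<and> narr s' = narr s \<and> rarr s' ''v'' = rarr s ''v'')"
  have env': "nvar s' ''S'' = S" "nvar s' ''A'' = A" "nvar s' ''n'' = n" "rarr s' ''v'' (n * S + j) = row s n j"
    if "base s'" for s' j
    using that env same_nvar[of ?NV "{}" s s'] by (auto simp: base_def env_def row_def)
  define Ia where "Ia = (\<lambda>a s'. base s' \<and> nvar s' ''a'' = a \<and>
    (\<forall>a'<a. \<forall>i<S. rarr s' ''off'' (a' * S + i) = ?E a' i))"
  define Ii where "Ii = (\<lambda>a i s'. Ia a s' \<and> nvar s' ''i'' = i \<and>
    (\<forall>i'<i. rarr s' ''off'' (a * S + i') = ?E a i'))"
  define Ij where "Ij = (\<lambda>a i j s'. Ii a i s' \<and> nvar s' ''j'' = j \<and>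
    rarr s' ''off'' (a * S + i) = (\<Sum>j'<j. pmf (trans X a i) j' * row s n j'))"
  have neq: "a' * S + i' \<noteq> a * S + i" if "a' < a" "i' < S" for a a' i i'
    using mult_le_mono1[of "Suc a'" a S] that unfolding mult_Suc by linarith
  have "ok (exec X D offset_loop s) (real A * (real S * (3 * real S + 5) + 4) + 2) (Ia A) (\<lambda>_. 0) 0"
    unfolding offset_loop_def
  proof (rule ok_For_det[where T = "\<lambda>_. real S * (3 * real S + 5) + 2"])
    fix a s1 assume a: "a < A" and Ia: "Ia a s1"
    let ?Wa = "\<lambda>s'. nvar s' ''a'' = a \<and> Ia (Suc a) (set_nvar ''a'' (Suc a) s')"
    have "ok (exec X D (For ''i'' (NVar ''S'')
     (Seq (RStore ''off'' off_cell (OfNat (NLit 0)))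
     (For ''j'' (NVar ''S'')
        add_offset))) s1)
       (real S * (3 * real S + 5) + 2) (Ii a S) (\<lambda>_. 0) 0"
    proof (rule ok_For_det[where T = "\<lambda>_. 3 * real S + 3"])
      fix i s2 assume i: "i < S" and Ii: "Ii a i s2"
      define s3 where "s3 = s2\<lparr>rarr := (rarr s2)(''off'' := (rarr s2 ''off'')(a * S + i := 0))\<rparr>"
      let ?Wi = "\<lambda>s'. nvar s' ''i'' = i \<and> Ii a (Suc i) (set_nvar ''i'' (Suc i) s')"
      have b2: "base s2" and a2: "nvar s2 ''a'' = a" "nvar s2 ''i'' = i"
        using Ii by (auto simp: Ii_def Ia_def)
      have "ok (exec X D (For ''j'' (NVar ''S'')
        add_offset) s3)
         (3 * real S + 2) (Ij a i S) (\<lambda>_. 0) 0"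
      proof (rule ok_For_det[where T = "\<lambda>_. 1"])
        fix j s4 assume j: "j < S" and Ij: "Ij a i j s4"
        have b4: "base s4" and a4: "nvar s4 ''a'' = a" "nvar s4 ''i'' = i" "nvar s4 ''j'' = j"
          using Ij by (auto simp: Ij_def Ii_def Ia_def)
        define s5 where "s5 = s4\<lparr>rarr := (rarr s4)(''off'' := (rarr s4 ''off'')(a * S + i :=
           rarr s4 ''off'' (a * S + i) + pmf (trans X a i) j * row s n j))\<rparr>"
        have "exec X D add_offset s4
            = return_spmf (s5, 1)"
          using env'[OF b4] by (simp add: a4 s5_def)
        moreover have "Ij a i (Suc j) (set_nvar ''j'' (Suc j) s5)"
        proof -
          have "base (set_nvar ''j'' (Suc j) s5)" using b4 by (simp add: base_def s5_def same_def)
          moreover have "\<forall>a'<a. \<forall>i'<S. rarr s5 ''off'' (a' * S + i') = ?E a' i'"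
            using Ij neq by (simp add: s5_def Ij_def Ii_def Ia_def)
          moreover have "\<forall>i'<i. rarr s5 ''off'' (a * S + i') = ?E a i'"
            using Ij by (simp add: s5_def Ij_def Ii_def)
          moreover have "rarr s5 ''off'' (a * S + i) = (\<Sum>j'<Suc j. pmf (trans X a i) j' * row s n j')"
            using Ij by (simp add: s5_def Ij_def)
          moreover have "nvar s5 = nvar s4" by (simp add: s5_def)
          ultimately show ?thesis
            using a4 by (simp add: Ij_def Ii_def Ia_def)
        qed
        moreover have "nvar s5 ''j'' = j" using a4 by (simp add: s5_def)
        ultimately show "ok (exec X D add_offset s4)
            1 (\<lambda>s'. nvar s' ''j'' = j \<and> Ij a i (Suc j) (set_nvar ''j'' (Suc j) s')) (\<lambda>_. 0) 0"
          by (auto intro!: ok_return)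
      next
        have "base s3" using b2 by (simp add: base_def s3_def same_def)
        then have "base (set_nvar ''j'' 0 s3)" by (simp add: base_def same_def)
        moreover have "\<forall>a'<a. \<forall>i'<S. rarr s3 ''off'' (a' * S + i') = ?E a' i'"
          using Ii neq by (simp add: s3_def Ii_def Ia_def)
        moreover have "\<forall>i'<i. rarr s3 ''off'' (a * S + i') = ?E a i'"
          using Ii by (simp add: s3_def Ii_def)
        moreover have "rarr s3 ''off'' (a * S + i) = 0" "nvar s3 = nvar s2" by (simp_all add: s3_def)
        ultimately show "Ij a i 0 (set_nvar ''j'' 0 s3)"
          using a2 by (simp add: Ij_def Ii_def Ia_def)
        show "nvar s' ''j'' = j \<and> nval s' (NVar ''S'') = S" if "Ij a i j s'" for j s'
          using that env'[of s'] by (simp add: Ij_def Ii_def Ia_def)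
      qed simp
      then have "ok (exec X D (For ''j'' (NVar ''S'')
        add_offset) s3)
         (3 * real S + 2) ?Wi (\<lambda>_. 0) 0"
      proof (rule ok_mono)
        fix s' assume Ij: "Ij a i S s'"
        then have "base s'" by (simp add: Ij_def Ii_def Ia_def)
        then have "base (set_nvar ''i'' (Suc i) s')" by (simp add: base_def same_def)
        with Ij show "?Wi s'"
          by (simp add: Ij_def Ii_def Ia_def less_Suc_eq expectation_sum[OF a i])
      qed simp_all
      then show "ok (exec X D (Seq (RStore ''off'' off_cell (OfNat (NLit 0)))
     (For ''j'' (NVar ''S'')
        add_offset)) s2)
         (3 * real S + 3) ?Wi (\<lambda>_. 0) 0"
        by (rule ok_Seq_return[where t = 1, rotated]) (use env'[OF b2] a2 in \<open>simp_all add: s3_def\<close>)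
    next
      have "base s1" using Ia by (simp add: Ia_def)
      then have "base (set_nvar ''i'' 0 s1)" by (simp add: base_def same_def)
      with Ia show "Ii a 0 (set_nvar ''i'' 0 s1)" by (simp add: Ii_def Ia_def)
      show "nvar s' ''i'' = i \<and> nval s' (NVar ''S'') = S" if "Ii a i s'" for i s'
        using that env'[of s'] by (simp add: Ii_def Ia_def)
    qed (simp add: algebra_simps)
    then show "ok (exec X D (For ''i'' (NVar ''S'')
     (Seq (RStore ''off'' off_cell (OfNat (NLit 0)))
     (For ''j'' (NVar ''S'')
        add_offset))) s1)
       (real S * (3 * real S + 5) + 2) ?Wa (\<lambda>_. 0) 0"
    proof (rule ok_mono)
      fix s' assume Ii: "Ii a S s'"
      then have "base s'" by (simp add: Ii_def Ia_def)
      then have "base (set_nvar ''a'' (Suc a) s')" by (simp add: base_def same_def)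
      with Ii show "?Wa s'"
        by (simp add: Ii_def Ia_def less_Suc_eq)
    qed simp_all
  next
    show "Ia 0 (set_nvar ''a'' 0 s)" by (simp add: Ia_def base_def same_def)
    show "nvar s' ''a'' = a \<and> nval s' (NVar ''A'') = A" if "Ia a s'" for a s'
      using that env'[of s'] by (simp add: Ia_def)
  qed (simp add: algebra_simps)
  then show ?thesis
  proof (rule ok_mono)
    fix s' assume Ia: "Ia A s'"
    then have "row s' n = row s n" by (simp add: Ia_def base_def row_def fun_eq_iff)
    with Ia show "same {''a'', ''i'', ''j''} {} s s' \<and> narr s' = narr s \<and> rarr s' ''v'' = rarr s ''v'' \<and> offsets n s'"
      by (simp add: Ia_def base_def offsets_def)
  qed simp_all
qed

end

section \<open>The loop over the horizon\<close>

definition main_loop :: com where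
  "main_loop = For ''n'' (NVar ''H'')
     (Seq (If (NLess (NAdd (NVar ''b'') (NVar ''k'')) (NVar ''n''))
              (Seq (NSet ''b'' (NVar ''n'')) offset_loop) Skip)
          state_loop)"

definition horizon_value :: "mdp \<Rightarrow> policy \<Rightarrow> nat \<Rightarrow> nat \<Rightarrow> nat \<Rightarrow> real" where
  "horizon_value X \<pi> n h i = measure_pmf.expectation (trajectory X \<pi> n h i)
     (\<lambda>\<omega>. \<Sum>l<n. reward X (\<pi> (\<omega> ! l) (h + l)) (\<omega> ! l))"

fun bellman_value :: "mdp \<Rightarrow> nat \<Rightarrow> nat \<Rightarrow> real" where
  "bellman_value X 0 i = 0"
| "bellman_value X (Suc n) i = Max ((\<lambda>a. backup X (bellman_value X n) a i) ` {..<n_actions X})"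

context sampled_iteration
begin

definition step_time :: real where
  "step_time = real S * (real A * (sample_time + 9) + 10) + 4"

definition offset_time :: real where
  "offset_time = real A * (real S * (3 * real S + 5) + 4) + 4"

text \<open>The loop rule wants the time of a round as a function of \<open>n\<close> alone, while
  the guard inspects \<open>''b''\<close>. Keeping \<open>''b''\<close> a multiple of
  \<open>Suc k\<close> ties them together: a new block can open only at positive multiples of
  \<open>Suc k\<close>.\<close>

lemma ok_main_loop:
  assumes env: "env s" "nvar s ''b'' = 0" "rarr s ''off'' = (\<lambda>_. 0)" "rarr s ''v'' = (\<lambda>_. 0)" "narr s ''pi'' = (\<lambda>_. 0)"
  shows "ok (exec X D main_loop s)
     ((\<Sum>n<H. (step_time + (if 0 < n \<and> Suc k dvd n then offset_time else 0)) + 2) + 2)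
     (\<lambda>s'. (\<forall>i<S. rarr s' ''v'' i = 0) \<and> (\<forall>n<H. \<forall>i<S. \<bar>row s' (Suc n) i - row s' n i\<bar> \<le> M) \<and>
        (\<forall>y. narr s' ''pi'' y < A))
     (\<lambda>s'. of_bool (\<not> (\<forall>n<H. \<forall>i<S. step_ok (rarr s' ''v'') (narr s' ''pi'') n i)))
     (of_nat H * (of_nat S * (of_nat A * ennreal (2 * exp (- L)))))"
proof -
  \<comment> \<open>At the start of a round \<open>n\<close> may equal \<open>''b'' + Suc k\<close>,
    one more than \<open>block\<close> permits; the conditional then opens a new block and restores
    the bound.\<close>
  define Inv where "Inv = (\<lambda>n s'. n \<le> H \<and> env s' \<and> nvar s' ''n'' = n \<and>
    Suc k dvd nvar s' ''b'' \<and> nvar s' ''b'' \<le> n \<and> n \<le> nvar s' ''b'' + Suc k \<and>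
    (\<forall>n'<n. \<forall>i<S. \<bar>row s' (Suc n') i - row s' n' i\<bar> \<le> M) \<and> offsets (nvar s' ''b'') s' \<and>
    (\<forall>i<S. rarr s' ''v'' i = 0) \<and> (\<forall>y. narr s' ''pi'' y < A))"
  define g where "g = (\<lambda>n (s' :: memory). \<forall>n'<n. \<forall>i<S. step_ok (rarr s' ''v'') (narr s' ''pi'') n' i)"
  let ?p = "of_nat S * (of_nat A * ennreal (2 * exp (- L)))"
  have "ok (exec X D main_loop s)
     ((\<Sum>n<H. (step_time + (if 0 < n \<and> Suc k dvd n then offset_time else 0)) + 2) + 2)
     (Inv H) (\<lambda>s'. of_bool (\<not> g H s')) (of_nat H * ?p)"
    unfolding main_loop_def
  proof (rule ok_For_fail)
    \<comment> \<open>The initial memory already stores the exact expectations of row 0, which is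
      zero, so the first block needs no exact computation.\<close>
    have "row (set_nvar ''n'' 0 s) 0 = (\<lambda>_. 0)"
      using env by (simp add: row_def fun_eq_iff)
    then show "Inv 0 (set_nvar ''n'' 0 s)"
      using env pos by (simp add: Inv_def env_def offsets_def)
    show "g 0 (set_nvar ''n'' 0 s)" by (simp add: g_def)
    show "nvar s' ''n'' = n \<and> nval s' (NVar ''H'') = H" if "Inv n s'" for n s'
      using that by (simp add: Inv_def env_def)
  next
    fix n s1 assume n: "n < H" and inv: "Inv n s1"
    have env1: "env s1" "nvar s1 ''n'' = n" and b1: "Suc k dvd nvar s1 ''b''" "nvar s1 ''b'' \<le> n" "n \<le> nvar s1 ''b'' + Suc k"
      and diff1: "\<And>n' i. n' < n \<Longrightarrow> i < S \<Longrightarrow> \<bar>row s1 (Suc n') i - row s1 n' i\<bar> \<le> M"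
      and off1: "offsets (nvar s1 ''b'') s1" and v1: "\<And>i. i < S \<Longrightarrow> rarr s1 ''v'' i = 0"
      and pi1: "\<And>y. narr s1 ''pi'' y < A"
      using inv by (auto simp: Inv_def)
    let ?t = "if 0 < n \<and> Suc k dvd n then offset_time else 0"
    let ?W = "\<lambda>s2. (\<exists>b. block n b s2 \<and> Suc k dvd b) \<and> rarr s2 ''v'' = rarr s1 ''v'' \<and> narr s2 ''pi'' = narr s1 ''pi''"
    have blk: "block n (nvar s' ''b'') s'"
      if "env s'" "nvar s' ''n'' = n" "nvar s' ''b'' \<le> n" "n \<le> nvar s' ''b'' + k"
        "offsets (nvar s' ''b'') s'" "rarr s' ''v'' = rarr s1 ''v''" for s'
      using that diff1 by (simp add: block_def row_def)
    have "ok (exec X D (If (NLess (NAdd (NVar ''b'') (NVar ''k'')) (NVar ''n''))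
              (Seq (NSet ''b'' (NVar ''n'')) offset_loop) Skip) s1) (?t + 2) ?W (\<lambda>_. ?p) ?p"
    proof (rule ok_If[where T = "?t + 1"])
      assume "bval X s1 (NLess (NAdd (NVar ''b'') (NVar ''k'')) (NVar ''n''))"
      then have "nvar s1 ''b'' + k < n" using env1 by (simp add: env_def)
      with b1 have nb: "n = nvar s1 ''b'' + Suc k" by simp
      have "Suc k dvd n" unfolding nb using b1(1) by (rule dvd_add) simp
      then have t: "?t = offset_time" using nb by simp
      define s2 where "s2 = set_nvar ''b'' n s1"
      have env2: "env s2" "nvar s2 ''n'' = n" using env1 by (simp_all add: s2_def env_def)
      have "ok (exec X D offset_loop s2) (real A * (real S * (3 * real S + 5) + 4) + 2) ?W (\<lambda>_. ?p) ?p"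
      proof (rule ok_const)
        show "ok (exec X D offset_loop s2) (real A * (real S * (3 * real S + 5) + 4) + 2) ?W (\<lambda>_. 0) 0"
        proof (rule ok_mono[OF ok_offset_loop[OF env2]])
          fix s' assume s': "same {''a'', ''i'', ''j''} {} s2 s' \<and> narr s' = narr s2 \<and> rarr s' ''v'' = rarr s2 ''v'' \<and> offsets n s'"
          then have "env s'" "nvar s' ''n'' = n" "nvar s' ''b'' = n"
            using env2 same_nvar[of "{''a'', ''i'', ''j''}" "{}" s2 s'] same_rvar[of "{''a'', ''i'', ''j''}" "{}" s2 s']
            by (simp_all add: env_def s2_def)
          with s' show "?W s'"
            using blk[of s'] \<open>Suc k dvd n\<close> by (auto simp: s2_def)
        qed simp_all
      qed simp
      then show "ok (exec X D (Seq (NSet ''b'' (NVar ''n'')) offset_loop) s1) (?t + 1) ?W (\<lambda>_. ?p) ?p"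
        by (rule ok_Seq_return[where t = 1, rotated]) (simp_all only: t, simp_all add: offset_time_def env1 s2_def)
    next
      assume "\<not> bval X s1 (NLess (NAdd (NVar ''b'') (NVar ''k'')) (NVar ''n''))"
      then have "n \<le> nvar s1 ''b'' + k" using env1 by (simp add: env_def)
      then have "?W s1" using blk[OF env1 b1(2) _ off1] b1(1) by auto
      moreover have "0 \<le> ?t" by (simp add: offset_time_def)
      ultimately show "ok (exec X D Skip s1) (?t + 1) ?W (\<lambda>_. ?p) ?p"
        by (auto intro!: ok_return)
    qed simp
    then show "ok (exec X D (Seq (If (NLess (NAdd (NVar ''b'') (NVar ''k'')) (NVar ''n''))
              (Seq (NSet ''b'' (NVar ''n'')) offset_loop) Skip) state_loop) s1)
         (step_time + ?t)
         (\<lambda>s'. nvar s' ''n'' = n \<and> Inv (Suc n) (set_nvar ''n'' (Suc n) s'))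
         (\<lambda>s'. of_bool (g n s1 \<and> \<not> g (Suc n) (set_nvar ''n'' (Suc n) s'))) ?p"
    proof (rule ok_Seq[where Tb = "real S * (real A * (sample_time + 9) + 10) + 2"])
      fix s2 assume W: "?W s2"
      then obtain b where b: "block n b s2" "Suc k dvd b" by auto
      have eq2: "rarr s2 ''v'' = rarr s1 ''v''" "narr s2 ''pi'' = narr s1 ''pi''" using W by auto
      have pi2: "\<And>y. narr s2 ''pi'' y < A" using pi1 eq2 by simp
      show "ok (exec X D state_loop s2) (real S * (real A * (sample_time + 9) + 10) + 2)
         (\<lambda>s'. nvar s' ''n'' = n \<and> Inv (Suc n) (set_nvar ''n'' (Suc n) s'))
         (\<lambda>s'. of_bool (g n s1 \<and> \<not> g (Suc n) (set_nvar ''n'' (Suc n) s'))) ?p"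
      proof (rule ok_mono[OF ok_state_loop[OF b(1) n pi2]])
        fix s3 assume s3: "same {''x'', ''j'', ''a'', ''arg'', ''i''} {''acc'', ''best''} s2 s3 \<and>
          rarr s3 ''off'' = rarr s2 ''off'' \<and> (\<forall>y < Suc n * S. rarr s3 ''v'' y = rarr s2 ''v'' y) \<and>
          (\<forall>y \<ge> (H - n) * S. narr s3 ''pi'' y = narr s2 ''pi'' y) \<and> (\<forall>y. narr s3 ''pi'' y < A) \<and>
          (\<forall>i<S. \<bar>row s3 (Suc n) i - row s2 n i\<bar> \<le> M)"
        then have same: "same {''x'', ''j'', ''a'', ''arg'', ''i''} {''acc'', ''best''} s2 s3"
          and v3: "\<And>y. y < Suc n * S \<Longrightarrow> rarr s3 ''v'' y = rarr s2 ''v'' y"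
          and pi3: "\<And>y. y \<ge> (H - n) * S \<Longrightarrow> narr s3 ''pi'' y = narr s2 ''pi'' y" "\<And>y. narr s3 ''pi'' y < A"
          and diff3: "\<And>i. i < S \<Longrightarrow> \<bar>row s3 (Suc n) i - row s2 n i\<bar> \<le> M"
          by auto
        have row3: "row s3 n' i = row s2 n' i" if "n' \<le> n" "i < S" for n' i
          using v3[OF cell_less[OF that]] by (simp add: row_def)
        have "block n b s3"
          by (rule block_cong[OF b(1)])
             (use s3 b(1) same_nvar[OF same] same_rvar[OF same] in \<open>simp_all add: block_def env_def\<close>)
        then have b3: "env s3" "nvar s3 ''n'' = n" "nvar s3 ''b'' = b" "b \<le> n" "n \<le> b + k" "offsets b s3"
          and diff: "\<forall>n'<n. \<forall>i<S. \<bar>row s3 (Suc n') i - row s3 n' i\<bar> \<le> M"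
          by (auto simp: block_def)
        have "\<forall>n'<Suc n. \<forall>i<S. \<bar>row s3 (Suc n') i - row s3 n' i\<bar> \<le> M"
          using diff diff3 row3 by (auto simp: less_Suc_eq)
        moreover have "\<forall>i<S. rarr s3 ''v'' i = 0"
          using v1 v3 eq2 by auto
        moreover have "row (set_nvar ''n'' (Suc n) s3) = row s3"
          by (simp add: row_def fun_eq_iff)
        ultimately show "nvar s3 ''n'' = n \<and> Inv (Suc n) (set_nvar ''n'' (Suc n) s3)"
          using n b b3 pi3(2) by (simp add: Inv_def env_def offsets_def)
        have "g (Suc n) (set_nvar ''n'' (Suc n) s3)"
          if g: "g n s1" and new: "\<forall>i<S. step_ok (rarr s3 ''v'') (narr s3 ''pi'') n i"
        proof -
          have "step_ok (rarr s3 ''v'') (narr s3 ''pi'') n' i" if "n' < n" "i < S" for n' i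
          proof (subst step_ok_cong[where v = "rarr s2 ''v''" and \<pi> = "narr s2 ''pi''"])
            show "step_ok (rarr s2 ''v'') (narr s2 ''pi'') n' i"
              using g that by (simp add: g_def eq2)
            show "rarr s3 ''v'' (Suc n' * S + i) = rarr s2 ''v'' (Suc n' * S + i)"
              using that by (intro v3 cell_less) auto
            show "rarr s3 ''v'' y = rarr s2 ''v'' y" if "y < Suc n' * S" for y
            proof (rule v3)
              have "Suc n' * S \<le> Suc n * S" using \<open>n' < n\<close> by (intro mult_le_mono1) auto
              with that show "y < Suc n * S" by linarith
            qed
            show "narr s3 ''pi'' ((H - n') * S + i) = narr s2 ''pi'' ((H - n') * S + i)"
              "narr s3 ''pi'' ((H - Suc n') * S + i) = narr s2 ''pi'' ((H - Suc n') * S + i)"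
              using that by (auto intro!: pi3 trans_le_add1 mult_le_mono1)
          qed (use that pi2 in auto)
          with new show ?thesis by (simp add: g_def less_Suc_eq)
        qed
        then show "of_bool (g n s1 \<and> \<not> g (Suc n) (set_nvar ''n'' (Suc n) s3)) \<le>
            (of_bool (\<not> (\<forall>i<S. step_ok (rarr s3 ''v'') (narr s3 ''pi'') n i)) :: ennreal)"
          by (auto simp: of_bool_def)
      qed simp_all
    qed (simp add: step_time_def)
  qed simp
  then show ?thesis
    by (rule ok_mono) (auto simp: Inv_def g_def)
qed

section \<open>Values of policies, optimal values, and the deterministic error analysis\<close>

lemma backup_mono:
  assumes "a < A" "i < S" "\<And>j. j < S \<Longrightarrow> f j \<le> g j + c"
  shows "backup X f a i \<le> backup X g a i + c"
proof -
  have "measure_pmf.expectation (trans X a i) f \<le> measure_pmf.expectation (trans X a i) (\<lambda>j. g j + c)"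
    using assms by (intro integral_mono_AE integrable_trans) (auto simp: AE_measure_pmf_iff set_trans)
  also have "\<dots> = measure_pmf.expectation (trans X a i) g + c"
    using integrable_trans[OF assms(1,2), of g] by simp
  finally show ?thesis by (simp add: backup_def)
qed

text \<open>Finite support makes all rewards along trajectories integrable, so expectations may be
  split into sums.\<close>

lemma finite_trajectory:
  assumes "\<pi> \<in> policies X"
  shows "i < S \<Longrightarrow> h + n \<le> H \<Longrightarrow> finite (set_pmf (trajectory X \<pi> n h i))"
proof (induction n arbitrary: h i)
  case (Suc n)
  then have a: "\<pi> i h < A" using assms by (simp add: policies_def)
  have "finite (set_pmf (trans X (\<pi> i h) i))"
    by (rule finite_subset[of _ "{..<S}"]) (use set_trans[OF a Suc.prems(1)] in blast, simp)
  with Suc set_trans[OF a Suc.prems(1)] show ?case by auto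
qed simp

text \<open>Every trajectory begins with its starting state, so the first summand is a constant and
  the rest is the reward of the tail; conditioning on the next state gives the recursion.\<close>

lemma horizon_value_Suc:
  assumes \<pi>: "\<pi> \<in> policies X" and i: "i < S" and h: "h + Suc n \<le> H"
  shows "horizon_value X \<pi> (Suc n) h i = backup X (horizon_value X \<pi> n (Suc h)) (\<pi> i h) i"
proof -
  have a: "\<pi> i h < A" using \<pi> i h by (simp add: policies_def)
  let ?r = "reward X (\<pi> i h) i"
  let ?R = "\<lambda>\<omega>. \<Sum>l<n. reward X (\<pi> (\<omega> ! l) (Suc h + l)) (\<omega> ! l)"
  have fin: "finite (set_pmf (trajectory X \<pi> n (Suc h) j))" if "j < S" for j
    by (rule finite_trajectory[OF \<pi> that]) (use h in simp)
  have "horizon_value X \<pi> (Suc n) h i =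
      measure_pmf.expectation (bind_pmf (trans X (\<pi> i h) i) (trajectory X \<pi> n (Suc h))) (\<lambda>\<omega>. ?r + ?R \<omega>)"
    by (simp add: horizon_value_def sum.lessThan_Suc_shift del: sum.lessThan_Suc)
  also have "\<dots> = (\<Sum>j<S. pmf (trans X (\<pi> i h) i) j *
      measure_pmf.expectation (trajectory X \<pi> n (Suc h) j) (\<lambda>\<omega>. ?r + ?R \<omega>))"
    using pmf_expectation_bind[of "{..<S}" "trajectory X \<pi> n (Suc h)" "trans X (\<pi> i h) i" "\<lambda>\<omega>. ?r + ?R \<omega>"]
      fin set_trans[OF a i] by (simp add: subset_iff)
  also have "\<dots> = (\<Sum>j<S. pmf (trans X (\<pi> i h) i) j * (?r + horizon_value X \<pi> n (Suc h) j))"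
    unfolding horizon_value_def
    by (intro sum.cong refl) (simp add: integrable_measure_pmf_finite fin)
  also have "\<dots> = measure_pmf.expectation (trans X (\<pi> i h) i) (\<lambda>j. ?r + horizon_value X \<pi> n (Suc h) j)"
    by (rule expectation_sum[OF a i, symmetric])
  also have "\<dots> = backup X (horizon_value X \<pi> n (Suc h)) (\<pi> i h) i"
    using integrable_trans[OF a i, of "horizon_value X \<pi> n (Suc h)"] by (simp add: backup_def)
  finally show ?thesis .
qed

lemma policy_value_eq: "policy_value X \<pi> i = horizon_value X \<pi> H 0 i"
  by (simp add: policy_value_def horizon_value_def)

lemma bellman_value_ge: "a < A \<Longrightarrow> backup X (bellman_value X n) a i \<le> bellman_value X (Suc n) i"
  by simp

lemma bellman_value_le:
  "(\<And>a. a < A \<Longrightarrow> backup X (bellman_value X n) a i \<le> c) \<Longrightarrow> bellman_value X (Suc n) i \<le> c"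
  using pos by (auto intro!: Max.boundedI)

lemma horizon_value_le_bellman:
  assumes \<pi>: "\<pi> \<in> policies X"
  shows "i < S \<Longrightarrow> h + n \<le> H \<Longrightarrow> horizon_value X \<pi> n h i \<le> bellman_value X n i"
proof (induction n arbitrary: h i)
  case (Suc n)
  then have a: "\<pi> i h < A" using \<pi> by (simp add: policies_def)
  have "horizon_value X \<pi> (Suc n) h i = backup X (horizon_value X \<pi> n (Suc h)) (\<pi> i h) i"
    by (rule horizon_value_Suc[OF \<pi>]) (use Suc in auto)
  also have "\<dots> \<le> backup X (bellman_value X n) (\<pi> i h) i + 0"
    by (rule backup_mono[OF a]) (use Suc in auto)
  also have "\<dots> \<le> bellman_value X (Suc n) i"
    using bellman_value_ge[OF a] by simp
  finally show ?case .
qed (simp add: horizon_value_def)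

text \<open>With one more step the optimum gains at most one reward: this holds for the first step,
  and monotone backups propagate it. It justifies the upper clamp, the one that could push a
  computed value below the optimum.\<close>

lemma bellman_value_Suc_le: "i < S \<Longrightarrow> bellman_value X (Suc n) i \<le> bellman_value X n i + M"
proof (induction n arbitrary: i)
  case 0
  have "bellman_value X 0 = (\<lambda>_. 0)" by (simp add: fun_eq_iff)
  then show ?case
    by (intro bellman_value_le) (use reward_bound 0 in \<open>force simp: backup_def abs_le_iff\<close>)
next
  case (Suc n)
  show ?case
  proof (rule bellman_value_le)
    fix a assume a: "a < A"
    have "backup X (bellman_value X (Suc n)) a i \<le> backup X (bellman_value X n) a i + M"
      by (rule backup_mono[OF a Suc.prems]) (rule Suc.IH)
    also have "\<dots> \<le> bellman_value X (Suc n) i + M"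
      using bellman_value_ge[OF a] by simp
    finally show "backup X (bellman_value X (Suc n)) a i \<le> bellman_value X (Suc n) i + M" .
  qed
qed

lemma policies_nonempty: "policies X \<noteq> {}"
  using pos by (auto simp: policies_def intro!: exI[of _ "\<lambda>_ _. 0"])

text \<open>The optimal value is squeezed between the value of the policy and
  \<open>bellman_value\<close>, which dominates the value of every policy.\<close>

lemma eps_optimalI:
  assumes \<pi>: "\<pi> \<in> policies X" and "\<And>i. i < S \<Longrightarrow> bellman_value X H i - \<epsilon> \<le> policy_value X \<pi> i"
  shows "eps_optimal X \<epsilon> \<pi>"
  unfolding eps_optimal_def
proof (intro conjI allI impI \<pi>)
  fix i assume i: "i < S"
  have le: "policy_value X \<pi>' i \<le> bellman_value X H i" if "\<pi>' \<in> policies X" for \<pi>'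
    using horizon_value_le_bellman[OF that i, of 0 H] by (simp add: policy_value_eq)
  then have "optimal_value X i \<le> bellman_value X H i"
    unfolding optimal_value_def by (intro cSUP_least policies_nonempty) auto
  moreover have "policy_value X \<pi> i \<le> optimal_value X i"
    unfolding optimal_value_def using le by (intro cSUP_upper \<pi> bdd_aboveI2) auto
  ultimately show "\<bar>optimal_value X i - policy_value X \<pi> i\<bar> \<le> \<epsilon>"
    using assms(2)[OF i] by linarith
qed

lemma horizon_value_ge:
  assumes \<pi>: "\<pi> \<in> policies X"
  shows "i < S \<Longrightarrow> h + n \<le> H \<Longrightarrow> - real n * M \<le> horizon_value X \<pi> n h i"
proof (induction n arbitrary: h i)
  case (Suc n)
  then have a: "\<pi> i h < A" using \<pi> by (simp add: policies_def)
  have "- real (Suc n) * M \<le> backup X (\<lambda>_. 0) (\<pi> i h) i - real n * M"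
    using reward_bound[OF a Suc.prems(1)] by (simp add: backup_def algebra_simps)
  also have "backup X (\<lambda>_. 0) (\<pi> i h) i \<le> backup X (horizon_value X \<pi> n (Suc h)) (\<pi> i h) i + real n * M"
  proof (rule backup_mono[OF a Suc.prems(1)])
    fix j assume "j < S"
    with Suc.IH[of j "Suc h"] Suc.prems show "0 \<le> horizon_value X \<pi> n (Suc h) j + real n * M" by simp
  qed
  finally show ?case
    using horizon_value_Suc[OF \<pi> Suc.prems] by simp
qed (simp add: horizon_value_def)

text \<open>All values over the whole horizon lie between \<open>-H M\<close> and
  \<open>H M\<close>, so any two differ by at most \<open>2 M H\<close>.\<close>

lemma eps_optimal_trivial:
  assumes "\<pi> \<in> policies X" "2 * M * real H \<le> \<epsilon>"
  shows "eps_optimal X \<epsilon> \<pi>"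
proof (rule eps_optimalI[OF assms(1)])
  fix i assume i: "i < S"
  have "bellman_value X n i \<le> real n * M" for n
  proof (induction n)
    case (Suc n)
    then show ?case using bellman_value_Suc_le[OF i, of n] by (simp add: algebra_simps del: bellman_value.simps(2))
  qed simp
  from this[of H] horizon_value_ge[OF assms(1) i, of 0 H] assms(2)
  show "bellman_value X H i - \<epsilon> \<le> policy_value X \<pi> i"
    by (simp add: policy_value_eq algebra_simps)
qed

text \<open>Two inductions on the steps to go lose \<open>e\<close> per step each:
  \<open>opt\<close> keeps \<open>V\<close> from falling far below the optimum, \<open>pol\<close>
  keeps the policy from falling far below \<open>V\<close>. Together they lose
  \<open>2 H e\<close>.\<close>

lemma eps_optimal_of_step_ok:
  assumes v0: "\<And>i. i < S \<Longrightarrow> v i = 0"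
    and diff: "\<And>n i. n < H \<Longrightarrow> i < S \<Longrightarrow> \<bar>v (Suc n * S + i) - v (n * S + i)\<bar> \<le> M"
    and p: "\<And>y. p y < A"
    and ok: "\<And>n i. n < H \<Longrightarrow> i < S \<Longrightarrow> step_ok v p n i"
    and \<epsilon>: "2 * real H * e \<le> \<epsilon>"
  shows "eps_optimal X \<epsilon> (\<lambda>i h. p (h * S + i))"
proof (rule eps_optimalI)
  define V where "V = (\<lambda>n j. v (n * S + j))"
  define \<pi> where "\<pi> = (\<lambda>i h. p (h * S + i))"
  show \<pi>: "(\<lambda>i h. p (h * S + i)) \<in> policies X" using p by (simp add: policies_def)
  have up: "V (Suc n) i \<le> V n i + M" and down: "V n i - M \<le> V (Suc n) i" if "n < H" "i < S" for n i
    using diff[OF that] by (auto simp: V_def abs_le_iff)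
  have new: "V n i - M \<le> backup X (V n) (p ((H - n) * S + i)) i + e \<Longrightarrow>
      V (Suc n) i \<le> backup X (V n) (p ((H - Suc n) * S + i)) i + e"
    and lower: "\<And>a. a < A \<Longrightarrow> min (backup X (V n) a i - e) (V n i + M) \<le> V (Suc n) i" if "n < H" "i < S" for n i
    using ok[OF that] by (auto simp: step_ok_def V_def)
  \<comment> \<open>This discharges the condition in \<open>step_ok\<close>: the inherited action
    attains the lower clamp. Its previous backup reached \<open>V n\<close>, and passing from the
    old row to the new one lowers a backup by at most \<open>M\<close>.\<close>
  have J: "V n i - M \<le> backup X (V n) (p ((H - n) * S + i)) i + e" if "n \<le> H" "i < S" for n i
    using that
  proof (induction n arbitrary: i)
    \<comment> \<open>No action has been chosen yet, but any will do: \<open>V 0\<close> is zero and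
      rewards are at least \<open>-M\<close>.\<close>
    case 0
    have "backup X (V 0) (p (H * S + i)) i = backup X (\<lambda>_. 0) (p (H * S + i)) i"
      by (rule backup_cong[OF p 0(2)]) (simp add: V_def v0)
    then show ?case
      using reward_bound[OF p 0(2), of "H * S + i"] v0[OF 0(2)] e by (auto simp: backup_def V_def abs_le_iff)
  next
    case (Suc n)
    have "V (Suc n) i \<le> backup X (V n) (p ((H - Suc n) * S + i)) i + e"
      by (rule new) (use Suc in auto)
    also have "backup X (V n) (p ((H - Suc n) * S + i)) i \<le> backup X (V (Suc n)) (p ((H - Suc n) * S + i)) i + M"
    proof (rule backup_mono[OF p])
      fix j assume "j < S"
      with down[of n j] Suc.prems show "V n j \<le> V (Suc n) j + M" by simp
    qed (use Suc in simp)
    finally show ?case by simp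
  qed
  have opt: "bellman_value X n i \<le> V n i + real n * e" if "n \<le> H" "i < S" for n i
    using that
  proof (induction n arbitrary: i)
    case 0
    then show ?case by (simp add: V_def v0)
  next
    case (Suc n)
    have n: "n < H" using Suc.prems by simp
    show ?case
    \<comment> \<open>If the step rose by the full \<open>M\<close>, the optimum rose no more than
      that. Otherwise the \<open>min\<close> in \<open>step_ok\<close> is decided by the backup, and
      the usual contraction-free error recursion applies.\<close>
    proof (cases "V n i + M \<le> V (Suc n) i")
      case True
      have "bellman_value X (Suc n) i \<le> bellman_value X n i + M"
        by (rule bellman_value_Suc_le[OF Suc.prems(2)])
      also have "\<dots> \<le> V n i + real n * e + M" using Suc n by simp
      also have "\<dots> \<le> V (Suc n) i + real (Suc n) * e" using True e by (simp add: algebra_simps)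
      finally show ?thesis .
    next
      case False
      show ?thesis
      proof (rule bellman_value_le)
        fix a assume a: "a < A"
        have "backup X (bellman_value X n) a i \<le> backup X (V n) a i + real n * e"
          by (rule backup_mono[OF a Suc.prems(2)]) (use Suc n in simp)
        also have "backup X (V n) a i \<le> V (Suc n) i + e"
          using lower[OF n Suc.prems(2) a] False by (auto simp: min_le_iff_disj)
        finally show "backup X (bellman_value X n) a i \<le> V (Suc n) i + real (Suc n) * e"
          by (simp add: algebra_simps)
      qed
    qed
  qed
  have pol: "V n i \<le> horizon_value X \<pi> n (H - n) i + real n * e" if "n \<le> H" "i < S" for n i
    using that
  proof (induction n arbitrary: i)
    case 0
    then show ?case by (simp add: V_def v0 horizon_value_def)
  next
    case (Suc n)
    have "V (Suc n) i \<le> backup X (V n) (\<pi> i (H - Suc n)) i + e"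
      unfolding \<pi>_def by (rule new) (use Suc J in auto)
    also have "backup X (V n) (\<pi> i (H - Suc n)) i \<le>
        backup X (horizon_value X \<pi> n (H - n)) (\<pi> i (H - Suc n)) i + real n * e"
      by (rule backup_mono) (use Suc p in \<open>auto simp: \<pi>_def\<close>)
    also have "backup X (horizon_value X \<pi> n (H - n)) (\<pi> i (H - Suc n)) i = horizon_value X \<pi> (Suc n) (H - Suc n) i"
      using horizon_value_Suc[OF \<pi> Suc.prems(2), of "H - Suc n" n] Suc.prems(1)
      by (simp add: \<pi>_def Suc_diff_Suc)
    finally show ?case by (simp add: algebra_simps)
  qed
  fix i assume i: "i < S"
  show "bellman_value X H i - \<epsilon> \<le> policy_value X (\<lambda>i h. p (h * S + i)) i"
    using opt[OF order_refl i] pol[OF order_refl i] \<epsilon> by (simp add: policy_value_eq \<pi>_def algebra_simps)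
qed

end

section \<open>Choice of parameters and running time\<close>

abbreviation few_doublings :: bexp where
  "few_doublings \<equiv> RLess (RMul (RVar ''y'') (RVar ''delta''))
                  (OfNat (NMul (NLit 2) (NMul (NMul (NVar ''S'') (NVar ''A'')) (NVar ''H''))))"

abbreviation short_block :: bexp where
  "short_block \<equiv> And (NLess (NAdd (NVar ''k'') (NLit 1)) (NVar ''H''))
                  (Not (RLess (RMul (OfNat (NVar ''S'')) (RMul (RVar ''epsilon'') (RVar ''epsilon'')))
                     (RMul (RMul (OfNat (NAdd (NVar ''k'') (NLit 1))) (RMul (OfNat (NAdd (NVar ''k'') (NLit 1))) (OfNat (NAdd (NVar ''k'') (NLit 1)))))
                       (RMul (RMul (OfNat (NVar ''H'')) (RVar ''M'')) (RMul (OfNat (NVar ''H'')) (RVar ''M''))))))"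

abbreviation few_samples :: bexp where
  "few_samples \<equiv> RLess (RMul (OfNat (NVar ''m'')) (RMul (RVar ''epsilon'') (RVar ''epsilon'')))
                (RMul (OfNat (NMul (NLit 8) (NVar ''L'')))
                  (RMul (RMul (OfNat (NMul (NVar ''k'') (NVar ''H''))) (RVar ''M''))
                        (RMul (OfNat (NMul (NVar ''k'') (NVar ''H''))) (RVar ''M''))))"

text \<open>
  Without logarithms, roots and rounding, the three parameters are found by linear search, which
  is cheap enough: \<open>2 ^ L \<ge> 2 S A H / \<delta>\<close>, the block parameter \<open>k\<close>, and the number \<open>m\<close> of samples.
\<close>
definition parameter_search :: com where
  "parameter_search = Seq (RSet ''y'' (OfNat (NLit 1)))
    (Seq (While few_doublings
            (Seq (RSet ''y'' (RAdd (RVar ''y'') (RVar ''y''))) (NSet ''L'' (NAdd (NVar ''L'') (NLit 1)))))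
    (Seq (While short_block
            (NSet ''k'' (NAdd (NVar ''k'') (NLit 1))))
     (While few_samples
        (NSet ''m'' (NAdd (NVar ''m'') (NLit 1))))))"

text \<open>For \<open>\<epsilon> \<ge> 2 H M\<close> the array \<open>''pi''\<close> of the initial
  memory, all zero, is already a correct answer.\<close>

definition solver :: com where
  "solver = If (RLess (RVar ''epsilon'') (RMul (OfNat (NMul (NLit 2) (NVar ''H''))) (RVar ''M'')))
     (Seq parameter_search main_loop) Skip"

text \<open>Each number is the first at which its search stops, with denominators cleared. The
  condition on \<open>L\<close> serves the union bound over \<open>S A H\<close> estimates, each
  failing with probability at most \<open>2 exp (- L)\<close>. The 8 is the 2 of Hoeffding's bound
  times the 4 from squaring \<open>e = \<epsilon> / (2 H)\<close>.\<close>

locale parameters =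
  fixes S A H :: nat and M \<epsilon> \<delta> :: real and L k m :: nat
  assumes pos: "0 < S" "0 < A" "0 < H" "0 < M" "0 < \<epsilon>" "0 < \<delta>" "\<delta> < 1"
    and L: "2 * (S * A * H) \<le> 2 ^ L * \<delta>" "\<And>j. j < L \<Longrightarrow> 2 ^ j * \<delta> < 2 * (S * A * H)"
    and k: "Suc k < H \<Longrightarrow> S * \<epsilon>\<^sup>2 < real (Suc k) ^ 3 * (H * M)\<^sup>2"
      "\<And>j. j < k \<Longrightarrow> Suc j < H \<and> real (Suc j) ^ 3 * (H * M)\<^sup>2 \<le> S * \<epsilon>\<^sup>2"
    and m: "8 * L * (k * H * M)\<^sup>2 \<le> m * \<epsilon>\<^sup>2" "\<And>j. j < m \<Longrightarrow> j * \<epsilon>\<^sup>2 < 8 * L * (k * H * M)\<^sup>2"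

text \<open>The existence of these least numbers is the termination of the searches: powers of 2 are
  unbounded, the block search is capped by \<open>H\<close>, and multiples of
  \<open>\<epsilon>\<^sup>2\<close> are unbounded.\<close>

lemma ex_parameters:
  assumes "0 < S" "0 < A" "0 < H" "0 < M" "0 < \<epsilon>" "0 < \<delta>" "\<delta> < 1"
  shows "\<exists>L k m. parameters S A H M \<epsilon> \<delta> L k m"
proof -
  have first: "\<exists>n. P n \<and> (\<forall>j<n. \<not> P j)" if "\<exists>n. P n" for P :: "nat \<Rightarrow> bool"
    using that by (metis LeastI_ex not_less_Least)
  obtain n where "real (2 * (S * A * H)) / \<delta> < 2 ^ n"
    using real_arch_pow[of 2] by auto
  then have "real (2 * (S * A * H)) < 2 ^ n * \<delta>"
    unfolding pos_divide_less_eq[OF \<open>0 < \<delta>\<close>] .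
  then have "\<exists>n. real (2 * (S * A * H)) \<le> 2 ^ n * \<delta>"
    by (meson less_imp_le)
  from first[OF this] obtain L where L: "real (2 * (S * A * H)) \<le> 2 ^ L * \<delta>" "\<forall>j<L. \<not> real (2 * (S * A * H)) \<le> 2 ^ j * \<delta>"
    by blast
  have K: "\<exists>k. Suc k < H \<longrightarrow> S * \<epsilon>\<^sup>2 < real (Suc k) ^ 3 * (H * M)\<^sup>2" by (intro exI[of _ H]) simp
  from first[OF K] obtain k where k: "Suc k < H \<longrightarrow> S * \<epsilon>\<^sup>2 < real (Suc k) ^ 3 * (H * M)\<^sup>2"
      "\<forall>j<k. \<not> (Suc j < H \<longrightarrow> S * \<epsilon>\<^sup>2 < real (Suc j) ^ 3 * (H * M)\<^sup>2)"
    by blast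
  obtain n where "8 * L * (k * H * M)\<^sup>2 / \<epsilon>\<^sup>2 < real n"
    using reals_Archimedean2 by blast
  then have "8 * L * (k * H * M)\<^sup>2 < real n * \<epsilon>\<^sup>2"
    using assms by (subst (asm) pos_divide_less_eq) auto
  then have "\<exists>n. 8 * L * (k * H * M)\<^sup>2 \<le> real n * \<epsilon>\<^sup>2"
    by (meson less_imp_le)
  from first[OF this] obtain m where m: "8 * L * (k * H * M)\<^sup>2 \<le> real m * \<epsilon>\<^sup>2" "\<forall>j<m. \<not> 8 * L * (k * H * M)\<^sup>2 \<le> real j * \<epsilon>\<^sup>2"
    by blast
  have "parameters S A H M \<epsilon> \<delta> L k m"
    using assms L k m unfolding parameters_def not_le not_less not_imp by blast
  then show ?thesis by blast
qed

context parameters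
begin

lemma ok_parameter_search:
  assumes s: "nvar s ''S'' = S" "nvar s ''A'' = A" "nvar s ''H'' = H" "rvar s ''M'' = M"
      "rvar s ''epsilon'' = \<epsilon>" "rvar s ''delta'' = \<delta>"
      "nvar s ''L'' = 0" "nvar s ''k'' = 0" "nvar s ''m'' = 0"
  shows "ok (exec X D parameter_search s) (3 * real L + 2 * real k + 2 * real m + 4)
    (\<lambda>s'. same {''L'', ''k'', ''m''} {''y''} s s' \<and> narr s' = narr s \<and> rarr s' = rarr s \<and>
       nvar s' ''k'' = k \<and> nvar s' ''m'' = m) (\<lambda>_. 0) 0"
proof -
  let ?NV = "{''L'', ''k'', ''m''}" and ?RV = "{''y''}"
  define W where "W = (\<lambda>l k' m' s'. same ?NV ?RV s s' \<and> narr s' = narr s \<and> rarr s' = rarr s \<and>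
    nvar s' ''L'' = l \<and> nvar s' ''k'' = k' \<and> nvar s' ''m'' = m')"
  have vars: "nvar s' ''S'' = S" "nvar s' ''A'' = A" "nvar s' ''H'' = H" "rvar s' ''M'' = M"
      "rvar s' ''epsilon'' = \<epsilon>" "rvar s' ''delta'' = \<delta>" "nvar s' ''L'' = l" "nvar s' ''k'' = k'" "nvar s' ''m'' = m'"
    if "W l k' m' s'" for l k' m' s'
    using that s same_nvar[of ?NV ?RV s s'] same_rvar[of ?NV ?RV s s'] by (auto simp: W_def)
  show ?thesis
    unfolding parameter_search_def
  proof (rule ok_Seq_return)
    let ?s1 = "s\<lparr>rvar := (rvar s)(''y'' := 1)\<rparr>"
    show "exec X D (RSet ''y'' (OfNat (NLit 1))) s = return_spmf (?s1, 1)" by simp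
    let ?InvL = "\<lambda>j s'. W j 0 0 s' \<and> rvar s' ''y'' = 2 ^ j"
    let ?InvK = "\<lambda>j s'. W L j 0 s'"
    let ?InvM = "\<lambda>j s'. W L k j s'"
    show "ok (exec X D
      (Seq (While few_doublings
            (Seq (RSet ''y'' (RAdd (RVar ''y'') (RVar ''y''))) (NSet ''L'' (NAdd (NVar ''L'') (NLit 1)))))
      (Seq (While short_block
            (NSet ''k'' (NAdd (NVar ''k'') (NLit 1))))
      (While few_samples
        (NSet ''m'' (NAdd (NVar ''m'') (NLit 1)))))) ?s1)
      (3 * real L + 1 + (2 * real k + 1 + (2 * real m + 1)))
      (\<lambda>s'. same ?NV ?RV s s' \<and> narr s' = narr s \<and> rarr s' = rarr s \<and> nvar s' ''k'' = k \<and> nvar s' ''m'' = m)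
      (\<lambda>_. 0) 0"
    proof (rule ok_Seq, rule ok_While[where Inv = ?InvL and T = "\<lambda>_. 2" and \<Phi> = "\<lambda>_ _. 0"])
      show "?InvL 0 ?s1" using s by (simp add: W_def same_def)
      fix j s' assume j: "j < L" and inv: "?InvL j s'"
      show "bval X s' few_doublings"
        using L(2)[OF j] vars[of j 0 0 s'] inv by simp
      have "W (Suc j) 0 0 (s'\<lparr>rvar := (rvar s')(''y'' := 2 ^ Suc j), nvar := (nvar s')(''L'' := Suc j)\<rparr>)"
        using inv by (simp add: W_def same_def)
      then show "ok (exec X D (Seq (RSet ''y'' (RAdd (RVar ''y'') (RVar ''y''))) (NSet ''L'' (NAdd (NVar ''L'') (NLit 1)))) s')
          2 (?InvL (Suc j)) (\<lambda>_. 0) 0"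
        using inv vars[of j 0 0 s'] by (auto intro!: ok_return)
    next
      fix s' assume inv: "?InvL L s'"
      show "\<not> bval X s' few_doublings"
        using L(1) vars[of L 0 0 s'] inv by simp
    next
      show "(\<Sum>i<L. 2 + 1) + 1 \<le> 3 * real L + 1" by simp
      fix s1 assume s1: "?InvL L s1"
      show "ok (exec X D
        (Seq (While short_block
            (NSet ''k'' (NAdd (NVar ''k'') (NLit 1))))
        (While few_samples
        (NSet ''m'' (NAdd (NVar ''m'') (NLit 1))))) s1)
        (2 * real k + 1 + (2 * real m + 1))
        (\<lambda>s'. same ?NV ?RV s s' \<and> narr s' = narr s \<and> rarr s' = rarr s \<and> nvar s' ''k'' = k \<and> nvar s' ''m'' = m)
        (\<lambda>_. 0) 0"
      proof (rule ok_Seq, rule ok_While[where Inv = ?InvK and T = "\<lambda>_. 1" and \<Phi> = "\<lambda>_ _. 0"])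
        show "?InvK 0 s1" using s1 by simp
        fix j s' assume j: "j < k" and inv: "?InvK j s'"
        show "bval X s' short_block"
          using k(2)[OF j] vars[of L j 0 s'] inv by (simp add: power3_eq_cube power2_eq_square mult.assoc not_less)
        have "W L (Suc j) 0 (s'\<lparr>nvar := (nvar s')(''k'' := Suc j)\<rparr>)"
          using inv by (simp add: W_def same_def)
        then show "ok (exec X D (NSet ''k'' (NAdd (NVar ''k'') (NLit 1))) s') 1 (?InvK (Suc j)) (\<lambda>_. 0) 0"
          using inv vars[of L j 0 s'] by (auto intro!: ok_return)
      next
        fix s' assume inv: "?InvK k s'"
        show "\<not> bval X s' short_block"
          using k(1) vars[of L k 0 s'] inv by (simp add: power3_eq_cube power2_eq_square mult.assoc)
      next
        show "(\<Sum>i<k. 1 + 1) + 1 \<le> 2 * real k + 1" by simp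
        fix s2 assume s2: "?InvK k s2"
        have "ok (exec X D (While few_samples
          (NSet ''m'' (NAdd (NVar ''m'') (NLit 1)))) s2) (2 * real m + 1) (?InvM m) (\<lambda>_. 0) 0"
        proof (rule ok_While[where Inv = ?InvM and T = "\<lambda>_. 1" and \<Phi> = "\<lambda>_ _. 0"])
          show "?InvM 0 s2" using s2 by simp
          fix j s' assume j: "j < m" and inv: "?InvM j s'"
          show "bval X s' few_samples"
            using m(2)[OF j] vars[of L k j s'] inv by (simp add: power2_eq_square)
          have "W L k (Suc j) (s'\<lparr>nvar := (nvar s')(''m'' := Suc j)\<rparr>)"
            using inv by (simp add: W_def same_def)
          then show "ok (exec X D (NSet ''m'' (NAdd (NVar ''m'') (NLit 1))) s') 1 (?InvM (Suc j)) (\<lambda>_. 0) 0"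
            using inv vars[of L k j s'] by (auto intro!: ok_return)
        next
          fix s' assume inv: "?InvM m s'"
          show "\<not> bval X s' few_samples"
            using m(1) vars[of L k m s'] inv by (simp add: power2_eq_square)
        qed simp
        then show "ok (exec X D (While few_samples
          (NSet ''m'' (NAdd (NVar ''m'') (NLit 1)))) s2) (2 * real m + 1)
          (\<lambda>s'. same ?NV ?RV s s' \<and> narr s' = narr s \<and> rarr s' = rarr s \<and> nvar s' ''k'' = k \<and> nvar s' ''m'' = m)
          (\<lambda>_. 0) 0"
          by (rule ok_mono) (auto simp: W_def)
      qed simp
    qed simp
  qed simp
qed

section \<open>The cost bound and the sizes of the parameters\<close>

definition cost :: real where
  "cost = real S powr (5/3) * real A * real H powr (5/3) * M powr (2/3) / \<epsilon> powr (2/3) * ln (real S * real A * real H / \<delta>)"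

text \<open>The real \<open>k\<close> that balances exact and sampled work; \<open>k\<close> is its floor, capped at \<open>H - 1\<close>.\<close>
definition \<rho> :: real where
  "\<rho> = (S * \<epsilon>\<^sup>2 / (H * M)\<^sup>2) powr (1/3)"

lemma rho: "0 < \<rho>" "\<rho> ^ 3 = S * \<epsilon>\<^sup>2 / (H * M)\<^sup>2"
proof -
  have *: "0 < S * \<epsilon>\<^sup>2 / (H * M)\<^sup>2" using pos by simp
  then show "0 < \<rho>" unfolding \<rho>_def powr_gt_zero by (rule less_imp_neq[THEN not_sym])
  have "\<rho> ^ 3 = \<rho> powr (real 3)" using \<open>0 < \<rho>\<close> by (rule powr_realpow[symmetric])
  also have "\<dots> = S * \<epsilon>\<^sup>2 / (H * M)\<^sup>2" using * unfolding \<rho>_def powr_powr by simp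
  finally show "\<rho> ^ 3 = S * \<epsilon>\<^sup>2 / (H * M)\<^sup>2" .
qed

text \<open>Up to the logarithm, the claimed bound is the exact work
  \<open>S\<^sup>2 A H / \<rho>\<close>. The exponents 5/3 arise as \<open>2 - 1/3\<close> for
  \<open>S\<close> and \<open>1 + 2/3\<close> for \<open>H\<close>.\<close>

lemma cost_eq: "cost = (real S)\<^sup>2 * A * H / \<rho> * ln (real S * real A * real H / \<delta>)"
proof -
  have "(real S)\<^sup>2 * A * H / \<rho> = S powr (5/3) * A * H powr (5/3) * M powr (2/3) / \<epsilon> powr (2/3)"
  proof -
    have "\<rho> = S powr (1/3) * \<epsilon> powr (2/3) / (H powr (2/3) * M powr (2/3))"
      using pos unfolding \<rho>_def
      by (simp add: powr_divide powr_mult powr_powr flip: powr_numeral)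
    moreover have "(real S)\<^sup>2 = S powr (5/3) * S powr (1/3)"
      using pos by (simp flip: powr_add powr_numeral)
    ultimately have "(real S)\<^sup>2 * A * H / \<rho> = S powr (5/3) * S powr (1/3) * A * H /
        (S powr (1/3) * \<epsilon> powr (2/3) / (H powr (2/3) * M powr (2/3)))"
      by (simp only:)
    also have "\<dots> = S powr (5/3) * A * (H * H powr (2/3)) * M powr (2/3) / \<epsilon> powr (2/3)"
      using pos by (simp add: field_simps)
    also have "H * H powr (2/3) = H powr (5/3)"
      using pos powr_add[of "real H" 1 "2/3"] by simp
    finally show ?thesis .
  qed
  then show ?thesis by (simp add: cost_def)
qed

text \<open>Monotonicity of the cube translates the search guard into a comparison with
  \<open>\<rho>\<close>. The strict upper bound on \<open>\<rho>\<close> may fail only at the cap,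
  where the whole horizon is a single block.\<close>

lemma k_bounds: "real k \<le> \<rho>" "k < H" "Suc k < H \<Longrightarrow> \<rho> < real (Suc k)"
proof -
  have HM: "0 < (H * M)\<^sup>2" using pos by simp
  show "real k \<le> \<rho>"
  proof (cases k)
    case (Suc j)
    then have "real k ^ 3 \<le> \<rho> ^ 3"
      using k(2)[of j] HM by (simp add: rho pos_le_divide_eq)
    then show ?thesis using rho(1) by (simp add: power_mono_iff)
  qed (use rho in simp)
  show "k < H" using k(2)[of "k - 1"] pos by (cases k) auto
  show "\<rho> < real (Suc k)" if "Suc k < H"
  proof -
    have "\<rho> ^ 3 < real (Suc k) ^ 3"
      using k(1)[OF that] HM by (simp only: rho pos_divide_less_eq)
    then show ?thesis by (rule power_less_imp_less_base) simp
  qed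
qed

text \<open>One doubling before the search stopped, the target was not reached, so
  \<open>2 ^ L\<close> is below four times the argument of the logarithm; the factor 2 comes from
  \<open>ln 2 \<ge> 1/2\<close>.\<close>

lemma L_bounds: "0 < L" "real L \<le> 2 + 2 * ln (real S * real A * real H / \<delta>)"
proof -
  have SAH: "1 \<le> real (S * A * H)" using pos by (simp flip: of_nat_mult)
  show L0: "0 < L"
  proof (rule ccontr)
    assume "\<not> 0 < L"
    then have "2 * real (S * A * H) \<le> \<delta>" using L(1) by simp
    then show False using SAH pos by linarith
  qed
  have "2 ^ (L - 1) * \<delta> < 2 * real (S * A * H)" using L(2)[of "L - 1"] L0 by simp
  moreover have "2 ^ L * \<delta> = 2 * (2 ^ (L - 1) * \<delta>)"
    using L0 by (cases L) simp_all
  ultimately have "2 ^ L * \<delta> < 4 * real (S * A * H)" by linarith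
  then have "2 ^ L < 4 * (real S * real A * real H / \<delta>)"
    using pos by (simp add: field_simps)
  then have "ln (2 ^ L) < ln (4 * (real S * real A * real H / \<delta>))"
    using pos by (subst ln_less_cancel_iff) auto
  also have "\<dots> = ln 4 + ln (real S * real A * real H / \<delta>)"
    using pos by (subst ln_mult) auto
  also have "ln (4 :: real) = 2 * ln 2"
    using ln_realpow[of "2 :: real" 2] by simp
  finally have *: "L * ln 2 < 2 * ln 2 + ln (real S * real A * real H / \<delta>)"
    by (simp add: ln_realpow)
  have ln2: "1 / 2 \<le> ln (2 :: real)" using ln2_ge_two_thirds by simp
  have l0: "0 \<le> ln (real S * real A * real H / \<delta>)"
    using pos SAH by (intro ln_ge_zero) (simp add: field_simps)
  show "real L \<le> 2 + 2 * ln (real S * real A * real H / \<delta>)"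
  \<comment> \<open>The negation makes \<open>L - 2\<close> positive, so that 1/2 may be replaced by
    the larger \<open>ln 2\<close> in the product.\<close>
  proof (rule ccontr)
    assume neg: "\<not> ?thesis"
    then have "2 * ln (real S * real A * real H / \<delta>) < real L - 2" by simp
    then have "ln (real S * real A * real H / \<delta>) < (real L - 2) * (1 / 2)" by simp
    also have "\<dots> \<le> (real L - 2) * ln 2"
      using ln2 neg l0 by (intro mult_left_mono) auto
    finally show False using * by (simp add: algebra_simps)
  qed
qed

text \<open>For \<open>k = 0\<close> every step is its own block and nothing is sampled. In general
  the search failed at \<open>m - 1\<close>; multiplying that inequality by \<open>\<rho>\<close>
  produces \<open>\<rho> ^ 3\<close>, whose value removes \<open>\<epsilon>\<close>,
  \<open>H\<close> and \<open>M\<close>.\<close>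

lemma m_bounds: "k = 0 \<Longrightarrow> m = 0" "real m * \<rho> \<le> \<rho> + 8 * real L * real S"
proof -
  show m0: "k = 0 \<Longrightarrow> m = 0"
    using m(2)[of 0] by (cases m) auto
  show "real m * \<rho> \<le> \<rho> + 8 * real L * real S"
  proof (cases "m = 0")
    case True
    then show ?thesis using rho(1) by simp
  next
    case False
    then have "(real m - 1) * \<epsilon>\<^sup>2 < 8 * real L * (real k * (H * M))\<^sup>2"
      using m(2)[of "m - 1"] by (simp add: of_nat_diff mult.assoc)
    also have "\<dots> = 8 * real L * (real k)\<^sup>2 * (H * M)\<^sup>2"
      by (simp add: power_mult_distrib)
    also have "\<dots> \<le> 8 * real L * \<rho>\<^sup>2 * (H * M)\<^sup>2"
      using k_bounds(1) by (intro mult_right_mono mult_left_mono power_mono) auto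
    finally have "(real m - 1) * \<epsilon>\<^sup>2 * \<rho> < 8 * real L * \<rho>\<^sup>2 * (H * M)\<^sup>2 * \<rho>"
      using rho(1) by (rule mult_strict_right_mono)
    also have "\<dots> = 8 * real L * (\<rho> ^ 3 * (H * M)\<^sup>2)"
      by (simp add: power2_eq_square power3_eq_cube)
    also have "\<rho> ^ 3 * (H * M)\<^sup>2 = S * \<epsilon>\<^sup>2"
      using pos by (simp add: rho)
    finally have "((real m - 1) * \<rho>) * \<epsilon>\<^sup>2 < (8 * real L * real S) * \<epsilon>\<^sup>2"
      by (simp add: mult_ac)
    then have "(real m - 1) * \<rho> < 8 * real L * real S"
      using pos by simp
    then show ?thesis by (simp add: algebra_simps)
  qed
qed

text \<open>The quotient counts the positive multiples of \<open>Suc q\<close> up to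
  \<open>h\<close>, that is, the exact recomputations.\<close>

lemma sum_dvd: "(\<Sum>n<Suc h. if 0 < n \<and> Suc q dvd n then c else (0 :: real)) = real (h div Suc q) * c"
proof (induction h)
  case (Suc h)
  have "Suc h div Suc q = (if Suc q dvd Suc h then Suc (h div Suc q) else h div Suc q)"
    by (simp add: div_Suc dvd_eq_mod_eq_0)
  with Suc show ?case by (simp add: algebra_simps)
qed simp

text \<open>Everything is compared with \<open>F\<close>, the exact work, and the logarithm
  \<open>l\<close>. A small \<open>\<epsilon>\<close> gives \<open>\<rho> \<le> 2 S\<close> and
  hence \<open>N \<le> 2 F\<close>, so linear terms are harmless; the sampling term is at most
  \<open>N + 8 L F\<close>, where \<open>L\<close> is of order \<open>l\<close> unless
  \<open>N = 1\<close>.\<close>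

lemma total_time_le:
  assumes small: "\<epsilon> < 2 * H * M" and t: "0 \<le> t"
  defines "off \<equiv> real A * (real S * (3 * real S + 5) + 4) + 4"
    and "step \<equiv> real S * (real A * (real m * (4 + t) + 9) + 10) + 4"
  shows "3 * real L + 2 * real k + 2 * real m + 5 +
     ((\<Sum>n<H. (step + (if 0 < n \<and> Suc k dvd n then off else 0)) + 2) + 2)
       \<le> (600 + 60 * t) * max 1 cost"
proof -
  define F where "F = (real S)\<^sup>2 * A * H / \<rho>"
  define l where "l = ln (real S * real A * real H / \<delta>)"
  define N where "N = real S * real A * real H"
  have cost: "cost = F * l" by (simp add: cost_eq F_def l_def)
  have ge1: "1 \<le> real S" "1 \<le> real A" "1 \<le> real H" using pos by auto
  have rho2: "\<rho> \<le> 2 * real S"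
  proof -
    have "\<rho> ^ 3 \<le> 4 * S"
    proof -
      have "\<epsilon>\<^sup>2 \<le> (2 * H * M)\<^sup>2" using small pos by (intro power_mono) auto
      then have "S * \<epsilon>\<^sup>2 \<le> 4 * S * (H * M)\<^sup>2" using ge1 by (simp add: power_mult_distrib)
      then show ?thesis using pos unfolding rho(2) by (subst pos_divide_le_eq) auto
    qed
    also have "\<dots> \<le> 8 * real S ^ 3"
    proof -
      have "real S ^ 1 \<le> real S ^ 3" using ge1 by (intro power_increasing) auto
      then show ?thesis using ge1 unfolding power_one_right by linarith
    qed
    also have "\<dots> = (2 * real S) ^ 3" by (simp add: power_mult_distrib)
    finally show ?thesis using rho(1) by (subst (asm) power_mono_iff) auto
  qed
  have N_eq: "N = real (S * A * H)" by (simp add: N_def)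
  have N1: "1 \<le> N"
    unfolding N_eq using pos by (simp flip: of_nat_mult)
  have N_F: "N \<le> 2 * F"
  proof -
    have "N * \<rho> \<le> N * (2 * real S)" using rho2 N1 by (intro mult_left_mono) auto
    also have "\<dots> = 2 * F * \<rho>" using rho(1) by (simp add: F_def N_def power2_eq_square)
    finally show ?thesis using rho(1) by simp
  qed
  have l0: "0 \<le> l"
    unfolding l_def N_def[symmetric] using N1 pos by (intro ln_ge_zero) (simp add: field_simps)
  have L: "real L \<le> 2 + 2 * l" using L_bounds(2) by (simp add: l_def)
  have sum: "(\<Sum>n<H. (step + (if 0 < n \<and> Suc k dvd n then off else 0)) + 2) =
      real H * (step + 2) + real ((H - 1) div Suc k) * off"
    using sum_dvd[of k off "H - 1"] pos by (simp add: sum.distrib algebra_simps)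
  show ?thesis
  \<comment> \<open>If \<open>N = 1\<close> and \<open>\<delta>\<close> is near 1, then
    \<open>l\<close> is near 0 and a constant time is not \<open>O(F l)\<close>. In this case
    nothing is sampled and the 1 in \<open>max 1 cost\<close> pays. For \<open>N \<ge> 2\<close> the
    logarithm is at least 1/2.\<close>
  proof (cases "N = 1")
    case True
    then have "S * A * H = 1" unfolding N_eq of_nat_eq_1_iff .
    then have one: "S = 1" "A = 1" "H = 1" by auto
    have km: "k = 0" "m = 0" using k_bounds(2) m_bounds(1) one by auto
    have "l \<le> 2 * cost"
      using mult_right_mono[OF N_F l0] True by (simp add: cost)
    have "3 * real L + 2 * real k + 2 * real m + 5 +
        ((\<Sum>n<H. (step + (if 0 < n \<and> Suc k dvd n then off else 0)) + 2) + 2) = 3 * real L + 32"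
      unfolding sum by (simp add: step_def one km)
    also have "\<dots> \<le> 38 + 12 * cost" using L \<open>l \<le> 2 * cost\<close> by simp
    also have "\<dots> \<le> 600 * max 1 cost" by simp
    also have "\<dots> \<le> (600 + 60 * t) * max 1 cost" using t by (intro mult_right_mono) auto
    finally show ?thesis .
  next
    case False
    then have "S * A * H \<noteq> 1" using N_eq by auto
    moreover have "S * A * H \<noteq> 0" using pos by simp
    ultimately have "2 \<le> S * A * H" by linarith
    from of_nat_mono[OF this, where 'a = real] have N2: "2 \<le> N"
      unfolding N_eq by (simp only: of_nat_numeral)
    have "1 / 2 \<le> ln (2 :: real)" using ln2_ge_two_thirds by simp
    also have "\<dots> \<le> l"
      unfolding l_def N_def[symmetric] using N2 pos
      by (subst ln_le_cancel_iff) (auto simp: field_simps intro: order_trans[of _ 2])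
    finally have l: "1 / 2 \<le> l" .
    have F1: "1 / 2 \<le> F" using N_F N1 by simp
    have Fc: "F \<le> 2 * cost"
      using mult_left_mono[OF l, of F] F1 by (simp add: cost)
    have lc: "l \<le> 2 * cost"
      using mult_right_mono[OF F1 l0] by (simp add: cost)
    have Nc: "N \<le> 4 * cost" using N_F Fc by simp
    have L6: "real L \<le> 6 * l" using L l by simp
    have HN: "real H \<le> N"
      using mult_right_mono[of 1 "real S * real A" "real H"] mult_mono[of 1 "real S" 1 "real A"] ge1
      by (simp add: N_def)
    have SHN: "real S * real H \<le> N"
      using mult_right_mono[of 1 "real A" "real S * real H"] ge1 by (simp add: N_def mult_ac)
    have "real k < real H" using k_bounds(2) by simp
    then have kc: "real k \<le> 4 * cost"
      using HN Nc by linarith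
    have Nm: "N * real m \<le> 52 * cost"
    proof -
      have "N * (real m * \<rho>) \<le> N * (\<rho> + 8 * real L * real S)"
        using m_bounds(2) N1 by (intro mult_left_mono) auto
      also have "\<dots> = (N + 8 * real L * F) * \<rho>"
        using rho(1) by (simp add: F_def N_def power2_eq_square field_simps)
      finally have "N * real m * \<rho> \<le> (N + 8 * real L * F) * \<rho>" by (simp add: mult.assoc)
      then have "N * real m \<le> N + 8 * real L * F" using rho(1) by simp
      also have "\<dots> \<le> 4 * cost + 8 * (6 * l) * F"
        using Nc L6 F1 by (intro add_mono mult_right_mono mult_left_mono) auto
      also have "\<dots> = 52 * cost" by (simp add: cost)
      finally show ?thesis .
    qed
    have mN: "real m \<le> N * real m" using mult_right_mono[OF N1, of "real m"] by simp
    \<comment> \<open>Below the cap, \<open>Suc k\<close> exceeds \<open>\<rho>\<close>, so there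
      are at most \<open>H / \<rho>\<close> recomputations of order \<open>S\<^sup>2 A\<close>, in
      total of order \<open>F\<close>. At the cap there are none.\<close>
    have off: "real ((H - 1) div Suc k) * off \<le> 32 * cost"
    proof (cases "Suc k < H")
      case True
      have "off \<le> 16 * (A * (real S)\<^sup>2)"
      proof -
        have S2: "real S \<le> (real S)\<^sup>2" using ge1 by (simp add: power2_eq_square)
        have "real S * (3 * real S + 5) + 4 = 3 * (real S)\<^sup>2 + 5 * real S + 4"
          by (simp add: algebra_simps power2_eq_square)
        also have "\<dots> \<le> 12 * (real S)\<^sup>2"
          using S2 ge1 by linarith
        finally have "off \<le> real A * (12 * (real S)\<^sup>2) + 4"
          unfolding off_def by (intro add_right_mono mult_left_mono) auto
        moreover have "1 \<le> real A * (real S)\<^sup>2"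
          using ge1 mult_mono[of 1 "real A" 1 "(real S)\<^sup>2"] by simp
        ultimately show ?thesis by simp
      qed
      moreover have "real ((H - 1) div Suc k) \<le> H / \<rho>"
      proof -
        have "real ((H - 1) div Suc k) \<le> real (H - 1) / real (Suc k)" by (rule of_nat_div_le_of_nat)
        also have "\<dots> \<le> H / \<rho>"
          using k_bounds(3)[OF True] rho(1) by (intro frac_le) auto
        finally show ?thesis .
      qed
      ultimately have "real ((H - 1) div Suc k) * off \<le> (H / \<rho>) * (16 * (A * (real S)\<^sup>2))"
        using rho(1) by (intro mult_mono) (auto simp: off_def)
      also have "\<dots> = 16 * F" by (simp add: F_def)
      finally show ?thesis using Fc by simp
    next
      case False
      then have "(H - 1) div Suc k = 0" by simp
      then show ?thesis using Nc N1 by simp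
    qed
    have "real H * (step + 2) = (N * real m) * (4 + t) + 9 * N + 10 * (real S * real H) + 6 * real H"
      by (simp add: step_def N_def algebra_simps)
    also have "\<dots> \<le> (52 * cost) * (4 + t) + 9 * N + 10 * N + 6 * N"
      using Nm SHN HN t by (intro add_mono mult_right_mono mult_left_mono) auto
    also have "\<dots> \<le> (308 + 52 * t) * cost" using Nc by (simp add: algebra_simps)
    finally have steps: "real H * (step + 2) \<le> (308 + 52 * t) * cost" .
    have "3 * real L + 2 * real k + 2 * real m + 5 +
        ((\<Sum>n<H. (step + (if 0 < n \<and> Suc k dvd n then off else 0)) + 2) + 2)
      \<le> 3 * (12 * cost) + 2 * (4 * cost) + 2 * (52 * cost) + 5 + (((308 + 52 * t) * cost + 32 * cost) + 2)"
      unfolding sum using L6 lc kc mN Nm steps off by linarith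
    also have "\<dots> = 7 + (488 + 52 * t) * cost" by (simp add: algebra_simps)
    also have "\<dots> \<le> 7 * max 1 cost + (488 + 52 * t) * max 1 cost"
      using t by (intro add_mono mult_left_mono) auto
    also have "\<dots> = (495 + 52 * t) * max 1 cost" by (simp add: algebra_simps)
    also have "\<dots> \<le> (600 + 60 * t) * max 1 cost" using t by (intro mult_right_mono) auto
    finally show ?thesis .
  qed
qed

end

lemma ok_solver:
  assumes "(I, D) \<in> instances \<tau>"
  defines "X \<equiv> the_mdp I"
  shows "ok (run solver (I, D))
     ((600 + 60 * max 0 \<tau>) * max 1 (parameters.cost (n_states X) (n_actions X) (horizon X) (bound I) (accuracy I) (failure I)))
     (\<lambda>_. True) (\<lambda>s. of_bool (\<not> eps_optimal X (accuracy I) (output_policy I s))) (ennreal (failure I))"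
proof -
  let ?S = "n_states X" and ?A = "n_actions X" and ?H = "horizon X"
  let ?M = "bound I" and ?\<epsilon> = "accuracy I" and ?\<delta> = "failure I"
  let ?s = "initial_memory I"
  have mdp: "finite_horizon_mdp X ?M" and smp: "valid_sampler X \<tau> D"
    and \<epsilon>: "0 < ?\<epsilon>" and \<delta>: "0 < ?\<delta>" "?\<delta> < 1"
    using assms by (auto simp: instances_def)
  have pos: "0 < ?S" "0 < ?A" "0 < ?H" "0 < ?M" using mdp by (auto simp: finite_horizon_mdp_def)
  obtain L k m where "parameters ?S ?A ?H ?M ?\<epsilon> ?\<delta> L k m"
    using ex_parameters[OF pos \<epsilon> \<delta>] by blast
  then interpret P: parameters ?S ?A ?H ?M ?\<epsilon> ?\<delta> L k m .
  let ?e = "?\<epsilon> / (2 * real ?H)"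
  interpret R: sampled_iteration X D \<tau> ?M ?e "real L" k m
  proof
    show "0 < real L" using P.L_bounds(1) by simp
    show "2 * (real k * ?M)\<^sup>2 * real L \<le> real m * ?e\<^sup>2"
      using P.m(1) pos by (simp add: power_mult_distrib power_divide field_simps)
  qed (use mdp smp pos \<epsilon> in auto)
  let ?C = "(600 + 60 * max 0 \<tau>) * max 1 P.cost"
  let ?G = "\<lambda>s. eps_optimal X ?\<epsilon> (output_policy I s)"
  have init: "nvar ?s ''S'' = ?S" "nvar ?s ''A'' = ?A" "nvar ?s ''H'' = ?H" "rvar ?s ''M'' = ?M"
      "rvar ?s ''epsilon'' = ?\<epsilon>" "rvar ?s ''delta'' = ?\<delta>"
      "nvar ?s ''L'' = 0" "nvar ?s ''k'' = 0" "nvar ?s ''m'' = 0" "nvar ?s ''b'' = 0"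
      "narr ?s = (\<lambda>_ _. 0)" "rarr ?s = (\<lambda>_ _. 0)"
    by (simp_all add: initial_memory_def X_def)
  have "2 \<le> ?C"
    using mult_mono[of 600 "600 + 60 * max 0 \<tau>" 1 "max 1 P.cost"] by simp
  have "ok (exec X D solver ?s) ?C (\<lambda>_. True) (\<lambda>s. of_bool (\<not> ?G s)) (ennreal ?\<delta>)"
    unfolding solver_def
  proof (rule ok_If[where T = "?C - 1"])
    assume "bval X ?s (RLess (RVar ''epsilon'') (RMul (OfNat (NMul (NLit 2) (NVar ''H''))) (RVar ''M'')))"
    then have small: "?\<epsilon> < 2 * ?H * ?M" by (simp add: init)
    let ?T = "(\<Sum>n<?H. (R.step_time + (if 0 < n \<and> Suc k dvd n then R.offset_time else 0)) + 2) + 2"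
    have T: "3 * real L + 2 * real k + 2 * real m + 5 + ?T \<le> ?C"
      using P.total_time_le[OF small, of "max 0 \<tau>"]
      by (simp only: R.step_time_def R.offset_time_def R.sample_time_def max.cobounded1 simp_thms)
    \<comment> \<open>The search uses powers of 2 and the tail bound uses \<open>exp\<close>; since
      \<open>exp 1 \<ge> 2\<close>, reaching \<open>2 S A H / \<delta>\<close> with
      \<open>2 ^ L\<close> suffices.\<close>
    have p: "of_nat ?H * (of_nat ?S * (of_nat ?A * ennreal (2 * exp (- real L)))) \<le> ennreal ?\<delta>"
    proof -
      have "(2 :: real) ^ L \<le> exp 1 ^ L"
        using exp_ge_add_one_self[of 1] by (intro power_mono) auto
      then have "2 ^ L * ?\<delta> \<le> exp (real L) * ?\<delta>"
        using \<delta> by (intro mult_right_mono) (auto simp: exp_of_nat_mult[of L 1, simplified])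
      then have "real (2 * (?S * ?A * ?H)) \<le> exp (real L) * ?\<delta>"
        using P.L(1) by simp
      then have "real ?H * (real ?S * (real ?A * (2 * exp (- real L)))) \<le> ?\<delta>"
        by (simp add: exp_minus field_simps)
      then show ?thesis
        by (simp add: ennreal_of_nat_eq_real_of_nat ennreal_leI flip: ennreal_mult)
    qed
    show "ok (exec X D (Seq parameter_search main_loop) ?s) (?C - 1) (\<lambda>_. True) (\<lambda>s. of_bool (\<not> ?G s)) (ennreal ?\<delta>)"
    proof (rule ok_Seq)
      show "ok (exec X D parameter_search ?s) (3 * real L + 2 * real k + 2 * real m + 4)
        (\<lambda>s'. same {''L'', ''k'', ''m''} {''y''} ?s s' \<and> narr s' = narr ?s \<and> rarr s' = rarr ?s \<and>
           nvar s' ''k'' = k \<and> nvar s' ''m'' = m) (\<lambda>_. ennreal ?\<delta>) (ennreal ?\<delta>)"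
        by (rule ok_const[OF ok_mono[OF P.ok_parameter_search]]) (auto simp: init)
      fix s' assume s': "same {''L'', ''k'', ''m''} {''y''} ?s s' \<and> narr s' = narr ?s \<and> rarr s' = rarr ?s \<and>
           nvar s' ''k'' = k \<and> nvar s' ''m'' = m"
      then have same: "same {''L'', ''k'', ''m''} {''y''} ?s s'" by simp
      have "ok (exec X D main_loop s') ?T
     (\<lambda>s'. (\<forall>i<?S. rarr s' ''v'' i = 0) \<and> (\<forall>n<?H. \<forall>i<?S. \<bar>R.row s' (Suc n) i - R.row s' n i\<bar> \<le> ?M) \<and>
        (\<forall>y. narr s' ''pi'' y < ?A))
     (\<lambda>s'. of_bool (\<not> (\<forall>n<?H. \<forall>i<?S. R.step_ok (rarr s' ''v'') (narr s' ''pi'') n i)))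
     (of_nat ?H * (of_nat ?S * (of_nat ?A * ennreal (2 * exp (- real L)))))"
        by (rule R.ok_main_loop)
           (use s' same_nvar[OF same] same_rvar[OF same] in \<open>simp_all add: R.env_def init\<close>)
      then show "ok (exec X D main_loop s') ?T (\<lambda>_. True) (\<lambda>s. of_bool (\<not> ?G s)) (ennreal ?\<delta>)"
      proof (rule ok_mono)
        fix s assume W: "(\<forall>i<?S. rarr s ''v'' i = 0) \<and> (\<forall>n<?H. \<forall>i<?S. \<bar>R.row s (Suc n) i - R.row s n i\<bar> \<le> ?M) \<and>
          (\<forall>y. narr s ''pi'' y < ?A)"
        have "?G s" if "\<forall>n<?H. \<forall>i<?S. R.step_ok (rarr s ''v'') (narr s ''pi'') n i"
          unfolding output_policy_def X_def[symmetric]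
          by (rule R.eps_optimal_of_step_ok[where v = "rarr s ''v''"])
             (use W that pos in \<open>auto simp: R.row_def\<close>)
        then show "of_bool (\<not> ?G s) \<le>
            (of_bool (\<not> (\<forall>n<?H. \<forall>i<?S. R.step_ok (rarr s ''v'') (narr s ''pi'') n i)) :: ennreal)"
          by (auto simp: of_bool_def)
      qed (use p in auto)
    qed (use T in linarith)
  next
    assume "\<not> bval X ?s (RLess (RVar ''epsilon'') (RMul (OfNat (NMul (NLit 2) (NVar ''H''))) (RVar ''M'')))"
    then have large: "2 * ?M * ?H \<le> ?\<epsilon>" by (simp add: init mult_ac)
    have "?G ?s"
      by (rule R.eps_optimal_trivial[OF _ large]) (use pos in \<open>simp add: policies_def output_policy_def init\<close>)
    then show "ok (exec X D Skip ?s) (?C - 1) (\<lambda>_. True) (\<lambda>s. of_bool (\<not> ?G s)) (ennreal ?\<delta>)"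
      using \<open>2 \<le> ?C\<close> by (auto intro!: ok_return)
  qed simp
  then show ?thesis by (simp add: run_def X_def)
qed

theorem theorem5p5:
  shows "\<exists>c :: com. \<forall>\<tau> :: real.
    (\<forall>(I, D) \<in> instances \<tau>.
       lossless_spmf (run c (I, D)) \<and>
       success_probability c (I, D) \<ge> 1 - failure I) \<and>
    soft_O (instances \<tau>) (expected_time c)
      (\<lambda>(I, D).
         let S = real (n_states (the_mdp I)); A = real (n_actions (the_mdp I));
             H = real (horizon (the_mdp I)); M = bound I; \<epsilon> = accuracy I; \<delta> = failure I
         in S powr (5/3) * A * H powr (5/3) * M powr (2/3) / \<epsilon> powr (2/3)
              * ln (S * A * H / \<delta>))"
proof (intro exI[of _ solver] allI conjI)
  fix \<tau> :: real
  show "\<forall>(I, D) \<in> instances \<tau>. lossless_spmf (run solver (I, D)) \<and>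
      success_probability solver (I, D) \<ge> 1 - failure I"
  proof clarify
    fix I D assume ID: "(I, D) \<in> instances \<tau>"
    then have "0 \<le> failure I" by (simp add: instances_def)
    with ok_solver[OF ID] ok_success[OF ok_solver[OF ID]]
    show "lossless_spmf (run solver (I, D)) \<and> success_probability solver (I, D) \<ge> 1 - failure I"
      by (simp add: success_probability_def ok_def)
  qed
  show "soft_O (instances \<tau>) (expected_time solver)
      (\<lambda>(I, D).
         let S = real (n_states (the_mdp I)); A = real (n_actions (the_mdp I));
             H = real (horizon (the_mdp I)); M = bound I; \<epsilon> = accuracy I; \<delta> = failure I
         in S powr (5/3) * A * H powr (5/3) * M powr (2/3) / \<epsilon> powr (2/3)
              * ln (S * A * H / \<delta>))"
    unfolding soft_O_def
  \<comment> \<open>The exponent 0 means that the logarithm displayed in the bound already absorbs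
    the one in the sample size. The sampling time \<open>\<tau>\<close> enters only the constant, so
    a single program serves every \<open>\<tau>\<close>.\<close>
  proof (intro exI[of _ "600 + 60 * max 0 \<tau>"] exI[of _ "0 :: nat"] ballI)
    fix ID assume "ID \<in> instances \<tau>"
    moreover obtain I D where ID: "ID = (I, D)" by (cases ID)
    ultimately have "(I, D) \<in> instances \<tau>" by simp
    note ok = ok_solver[OF this]
    from this obtain pos: "0 < n_states (the_mdp I)" "0 < n_actions (the_mdp I)" "0 < horizon (the_mdp I)"
        "0 < bound I" "0 < accuracy I" "0 < failure I" "failure I < 1"
      using \<open>(I, D) \<in> instances \<tau>\<close> by (auto simp: instances_def finite_horizon_mdp_def)
    obtain L k m where "parameters (n_states (the_mdp I)) (n_actions (the_mdp I)) (horizon (the_mdp I))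
        (bound I) (accuracy I) (failure I) L k m"
      using ex_parameters[OF pos] by blast
    from parameters.cost_def[OF this] ok
    show "expected_time solver ID \<le> ennreal ((600 + 60 * max 0 \<tau>) *
       max 1 ((\<lambda>(I, D).
         let S = real (n_states (the_mdp I)); A = real (n_actions (the_mdp I));
             H = real (horizon (the_mdp I)); M = bound I; \<epsilon> = accuracy I; \<delta> = failure I
         in S powr (5/3) * A * H powr (5/3) * M powr (2/3) / \<epsilon> powr (2/3)
              * ln (S * A * H / \<delta>)) ID) *
       (1 + ln (max 1 ((\<lambda>(I, D).
         let S = real (n_states (the_mdp I)); A = real (n_actions (the_mdp I));
             H = real (horizon (the_mdp I)); M = bound I; \<epsilon> = accuracy I; \<delta> = failure I
         in S powr (5/3) * A * H powr (5/3) * M powr (2/3) / \<epsilon> powr (2/3)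
              * ln (S * A * H / \<delta>)) ID))) ^ 0)"
      by (simp add: ID ok_def expected_time_def Let_def)
  qed
qed

end
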